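(* Let $b \in \mathbb{R}\setminus\{0\}$ and $t \in \mathbb{C}$. The operator $e^{-tL_b}$ on $L^2(\mathbb{T}_x\times\mathbb{R}_y)$, viewed as the graph closure of the operator defined on the span of the eigenfunctions $f_{bn,k}$ ($n\in\mathbb{Z}$, $k\in\mathbb{N}$) of $L_b$, is bounded if and only if either $t \in 2\pi i\mathbb{Z}$, or $\operatorname{Re} t > 0$ and $$R(t) := \frac{1}{2}\operatorname{Re} t - \frac{\cosh(\operatorname{Re} t) - \cos(\operatorname{Im} t)}{\sinh(\operatorname{Re} t)} \geq 0.$$
   Context: $\mathbb{N}=\{0,1,2,\dots\}$. $\mathbb{T}$ is the circle $[0,2\pi]$ with ends identified. The hypoelliptic Laplacian on the circle is $$L_b = \frac12\left(-\partial_y^2 + y^2 - 1\right) - b\,y\,\partial_x,$$ acting as an unbounded operator on $L^2(\mathbb{T}_x\times\mathbb{R}_y)$. The Hermite functions are $h_k(y) = (2^k k!\sqrt{\pi})^{-1/2}\left(y-\frac{d}{dy}\right)^k e^{-y^2/2}$, regarded as entire functions of $y$. The functions $$f_{bn,k}(x,y) = (2\pi)^{-1}e^{inx}h_k(y-ibn), \quad n\in\mathbb{Z},\ k\in\mathbb{N},$$ are eigenfunctions of $L_b$ with eigenvalues $\frac12(bn)^2+k$, and their span is dense in $L^2(\mathbb{T}\times\mathbb{R})$. On this span one defines, for any $t\in\mathbb{C}$ and any finitely non-zero family of complex numbers $\alpha_{n,k}$, $$e^{-tL_b}\Big(\sum\alpha_{n,k}f_{bn,k}\Big) = \sum e^{-t(\frac12(bn)^2+k)}\alpha_{n,k}f_{bn,k}.$$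 The operator $e^{-tL_b}$ is the closure of the graph of this operator; it is bounded when the operator on the span extends to a bounded operator on $L^2(\mathbb{T}\times\mathbb{R})$. *)

theory Defs
  imports "HOL-Probability.Probability" "HOL-Computational_Algebra.Polynomial"
begin

section \<open>The Hilbert space of square-integrable functions on circle times line\<close>

text \<open>
  The circle is represented by the fundamental domain $[0,2\pi]$; its two end points form a null
  set, so identifying them does not affect the space of square-integrable classes.
\<close>

definition cyl :: "(real \<times> real) measure"
  where "cyl = restrict_space lborel {0..2 * pi} \<Otimes>\<^sub>M lborel"

definition sq_integrable :: "(real \<times> real \<Rightarrow> complex) \<Rightarrow> bool"
  where "sq_integrable u \<longleftrightarrow> u \<in> borel_measurable cyl \<and> integrable cyl (\<lambda>z. (cmod (u z))\<^sup>2)"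

definition L2_rel :: "(real \<times> real \<Rightarrow> complex) \<Rightarrow> (real \<times> real \<Rightarrow> complex) \<Rightarrow> bool"
  where "L2_rel u v \<longleftrightarrow> sq_integrable u \<and> sq_integrable v \<and> (AE z in cyl. u z = v z)"

lemma sq_integrable_0: "sq_integrable (\<lambda>_. 0)"
  by (simp add: sq_integrable_def)

lemma sq_integrable_add:
  assumes "sq_integrable u" "sq_integrable v"
  shows "sq_integrable (\<lambda>z. u z + v z)"
proof -
  have [measurable]: "u \<in> borel_measurable cyl" "v \<in> borel_measurable cyl"
    using assms by (auto simp: sq_integrable_def)
  have bound: "(cmod (a + b))\<^sup>2 \<le> 2 * (cmod a)\<^sup>2 + 2 * (cmod b)\<^sup>2" for a b :: complex
  proof -
    have "(cmod (a + b))\<^sup>2 \<le> (cmod a + cmod b)\<^sup>2"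
      by (intro power_mono norm_triangle_ineq) simp
    also have "\<dots> \<le> 2 * (cmod a)\<^sup>2 + 2 * (cmod b)\<^sup>2"
      using sum_squares_bound[of "cmod a" "cmod b"] by (simp add: power2_sum)
    finally show ?thesis .
  qed
  have "integrable cyl (\<lambda>z. 2 * (cmod (u z))\<^sup>2 + 2 * (cmod (v z))\<^sup>2)"
    using assms by (auto simp: sq_integrable_def)
  then have "integrable cyl (\<lambda>z. (cmod (u z + v z))\<^sup>2)"
    by (rule Bochner_Integration.integrable_bound) (use bound in \<open>auto intro!: AE_I2 simp: abs_of_nonneg\<close>)
  then show ?thesis
    by (simp add: sq_integrable_def)
qed

lemma sq_integrable_mult:
  assumes "sq_integrable u"
  shows "sq_integrable (\<lambda>z. c * u z)"
  using assms by (auto simp: sq_integrable_def norm_mult power_mult_distrib)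

lemma sq_integrable_scaleR:
  assumes "sq_integrable u"
  shows "sq_integrable (\<lambda>z. r *\<^sub>R u z)"
  using sq_integrable_mult[OF assms, of "of_real r"] by (simp add: scaleR_conv_of_real)

lemma sq_integrable_uminus:
  assumes "sq_integrable u"
  shows "sq_integrable (\<lambda>z. - u z)"
  using sq_integrable_mult[OF assms, of "-1"] by simp

lemma sq_integrable_diff:
  assumes "sq_integrable u" "sq_integrable v"
  shows "sq_integrable (\<lambda>z. u z - v z)"
  using sq_integrable_add[OF assms(1) sq_integrable_uminus[OF assms(2)]] by simp

lemma sq_integrable_inner:
  assumes "sq_integrable u" "sq_integrable v"
  shows "integrable cyl (\<lambda>z. u z \<bullet> v z)"
proof -
  have [measurable]: "u \<in> borel_measurable cyl" "v \<in> borel_measurable cyl"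
    using assms by (auto simp: sq_integrable_def)
  have bound: "\<bar>a \<bullet> b\<bar> \<le> (cmod a)\<^sup>2 + (cmod b)\<^sup>2" for a b :: complex
    using Cauchy_Schwarz_ineq2[of a b] sum_squares_bound[of "cmod a" "cmod b"]
      mult_nonneg_nonneg[OF norm_ge_zero[of a] norm_ge_zero[of b]] by linarith
  have "integrable cyl (\<lambda>z. (cmod (u z))\<^sup>2 + (cmod (v z))\<^sup>2)"
    using assms by (auto simp: sq_integrable_def)
  then show ?thesis
    by (rule Bochner_Integration.integrable_bound) (use bound in \<open>auto intro!: AE_I2\<close>)
qed

quotient_type L2 = "real \<times> real \<Rightarrow> complex" / partial: L2_rel
proof (rule part_equivpI)
  show "\<exists>u. L2_rel u u"
    using sq_integrable_0 by (auto simp: L2_rel_def)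
  show "symp L2_rel"
    by (auto simp: L2_rel_def symp_def eq_commute)
  show "transp L2_rel"
    unfolding transp_def L2_rel_def by (auto elim: AE_mp)
qed

instantiation L2 :: real_inner
begin

lift_definition zero_L2 :: L2 is "\<lambda>_. 0"
  by (simp add: L2_rel_def sq_integrable_0)

lift_definition plus_L2 :: "L2 \<Rightarrow> L2 \<Rightarrow> L2" is "\<lambda>u v z. u z + v z"
  unfolding L2_rel_def by (auto intro: sq_integrable_add)

lift_definition minus_L2 :: "L2 \<Rightarrow> L2 \<Rightarrow> L2" is "\<lambda>u v z. u z - v z"
  unfolding L2_rel_def by (auto intro: sq_integrable_diff)

lift_definition uminus_L2 :: "L2 \<Rightarrow> L2" is "\<lambda>u z. - u z"
  unfolding L2_rel_def by (auto intro: sq_integrable_uminus)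

lift_definition scaleR_L2 :: "real \<Rightarrow> L2 \<Rightarrow> L2" is "\<lambda>r u z. r *\<^sub>R u z"
  unfolding L2_rel_def by (auto intro: sq_integrable_scaleR)

text \<open>
  On \<^typ>\<open>complex\<close>, the inner product of the class \<^class>\<open>real_inner\<close> is
  $\mathrm{Re}(\bar w z)$, so this is the real part of the Hermitian inner product.
\<close>

lift_definition inner_L2 :: "L2 \<Rightarrow> L2 \<Rightarrow> real" is "\<lambda>u v. LINT z|cyl. u z \<bullet> v z"
  unfolding L2_rel_def sq_integrable_def by (auto intro!: integral_cong_AE)

lift_definition norm_L2 :: "L2 \<Rightarrow> real" is "\<lambda>u. sqrt (LINT z|cyl. (cmod (u z))\<^sup>2)"
  unfolding L2_rel_def sq_integrable_def by (auto intro!: integral_cong_AE)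

definition dist_L2 :: "L2 \<Rightarrow> L2 \<Rightarrow> real"
  where "dist_L2 u v = norm (u - v)"

definition sgn_L2 :: "L2 \<Rightarrow> L2"
  where "sgn_L2 u = inverse (norm u) *\<^sub>R u"

definition uniformity_L2 :: "(L2 \<times> L2) filter"
  where "uniformity_L2 = (INF e\<in>{0<..}. principal {(u, v). dist u v < e})"

definition open_L2 :: "L2 set \<Rightarrow> bool"
  where "open_L2 U \<longleftrightarrow> (\<forall>u\<in>U. \<forall>\<^sub>F (u', v) in uniformity. u' = u \<longrightarrow> v \<in> U)"

instance
proof
  fix u v w :: L2 and r s :: real and U :: "L2 set"
  show "dist u v = norm (u - v)" by (rule dist_L2_def)
  show "sgn u = inverse (norm u) *\<^sub>R u" by (rule sgn_L2_def)
  show "uniformity = (INF e\<in>{0<..}. principal {(u, v :: L2). dist u v < e})"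
    by (rule uniformity_L2_def)
  show "open U = (\<forall>u\<in>U. \<forall>\<^sub>F (u', v) in uniformity. u' = u \<longrightarrow> v \<in> U)"
    by (rule open_L2_def)
  show "u + v + w = u + (v + w)"
    by transfer (auto simp: L2_rel_def add.assoc intro!: sq_integrable_add)
  show "u + v = v + u"
    by transfer (auto simp: L2_rel_def add.commute intro!: sq_integrable_add)
  show "0 + u = u"
    by transfer (auto simp: L2_rel_def)
  show "- u + u = 0"
    by transfer (auto simp: L2_rel_def sq_integrable_0)
  show "u - v = u + - v"
    by transfer (auto simp: L2_rel_def intro!: sq_integrable_diff)
  show "r *\<^sub>R (u + v) = r *\<^sub>R u + r *\<^sub>R v"
    by transfer (auto simp: L2_rel_def scaleR_add_right
        intro!: sq_integrable_add sq_integrable_scaleR)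
  show "(r + s) *\<^sub>R u = r *\<^sub>R u + s *\<^sub>R u"
    by transfer (auto simp: L2_rel_def scaleR_add_left
        intro!: sq_integrable_add sq_integrable_scaleR)
  show "r *\<^sub>R s *\<^sub>R u = (r * s) *\<^sub>R u"
    by transfer (auto simp: L2_rel_def mult.assoc intro!: sq_integrable_scaleR)
  show "1 *\<^sub>R u = u"
    by transfer (auto simp: L2_rel_def)
  show "u \<bullet> v = v \<bullet> u"
    by transfer (simp add: inner_commute)
  show "(u + v) \<bullet> w = u \<bullet> w + v \<bullet> w"
    by transfer (simp add: L2_rel_def inner_add_left sq_integrable_inner)
  show "r *\<^sub>R u \<bullet> v = r * (u \<bullet> v)"
    by transfer simp
  show "0 \<le> u \<bullet> u"
    by transfer simp
  show "u \<bullet> u = 0 \<longleftrightarrow> u = 0"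
  proof transfer
    fix u assume u: "L2_rel u u"
    then have "integrable cyl (\<lambda>z. u z \<bullet> u z)"
      by (auto simp: L2_rel_def intro: sq_integrable_inner)
    then have "(LINT z|cyl. u z \<bullet> u z) = 0 \<longleftrightarrow> (AE z in cyl. u z \<bullet> u z = 0)"
      by (intro integral_nonneg_eq_0_iff_AE) auto
    with u show "(LINT z|cyl. u z \<bullet> u z) = 0 \<longleftrightarrow> L2_rel u (\<lambda>_. 0)"
      by (auto simp: L2_rel_def sq_integrable_0)
  qed
  show "norm u = sqrt (u \<bullet> u)"
    by transfer (simp add: power2_norm_eq_inner)
qed

end

lift_definition scaleC_L2 :: "complex \<Rightarrow> L2 \<Rightarrow> L2" (infixr "*\<^sub>C" 75) is "\<lambda>c u z. c * u z"
  unfolding L2_rel_def by (auto intro: sq_integrable_mult)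


section \<open>Hermite functions and the eigenfunctions\<close>

definition hermite :: "nat \<Rightarrow> complex \<Rightarrow> complex"
  where "hermite k z =
    complex_of_real ((2 ^ k * fact k * sqrt pi) powr (- 1 / 2)) *
    ((\<lambda>g z. z * g z - deriv g z) ^^ k) (\<lambda>z. exp (- z\<^sup>2 / 2)) z"

definition eigfun :: "real \<Rightarrow> int \<Rightarrow> nat \<Rightarrow> real \<times> real \<Rightarrow> complex"
  where "eigfun b n k = (\<lambda>(x, y).
    complex_of_real (1 / (2 * pi)) * exp (\<i> * of_int n * of_real x) *
    hermite k (of_real y - \<i> * of_real b * of_int n))"

definition eigval :: "real \<Rightarrow> int \<Rightarrow> nat \<Rightarrow> real"
  where "eigval b n k = (b * of_int n)\<^sup>2 / 2 + real k"

definition hypoelliptic_laplacian ::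
    "real \<Rightarrow> (real \<times> real \<Rightarrow> complex) \<Rightarrow> real \<times> real \<Rightarrow> complex"
  where "hypoelliptic_laplacian b u = (\<lambda>(x, y).
    (- vector_derivative (\<lambda>s. vector_derivative (\<lambda>r. u (x, r)) (at s)) (at y)
      + of_real (y\<^sup>2) * u (x, y) - u (x, y)) / 2
    - of_real (b * y) * vector_derivative (\<lambda>s. u (s, y)) (at x))"

fun hermite_poly :: "nat \<Rightarrow> complex poly"
  where "hermite_poly 0 = 1"
  | "hermite_poly (Suc k) = [:0, 2:] * hermite_poly k - pderiv (hermite_poly k)"

lemma poly_gauss_has_field_derivative:
  fixes p :: "complex poly"
  shows "((\<lambda>z. poly p z * exp (- z\<^sup>2 / 2)) has_field_derivative
    poly (pderiv p - [:0, 1:] * p) z * exp (- z\<^sup>2 / 2)) (at z)"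
  by (auto intro!: derivative_eq_intros simp: algebra_simps)

lemma ladder_eq_hermite_poly:
  "((\<lambda>g z. z * g z - deriv g z) ^^ k) (\<lambda>z. exp (- z\<^sup>2 / 2)) =
    (\<lambda>z. poly (hermite_poly k) z * exp (- z\<^sup>2 / 2))"
proof (induction k)
  case (Suc k)
  show ?case
    unfolding funpow.simps o_def Suc
    by (simp only: DERIV_imp_deriv[OF poly_gauss_has_field_derivative] fun_eq_iff)
      (simp add: algebra_simps)
qed simp

lemma hermite_eq_poly:
  "hermite k z = complex_of_real ((2 ^ k * fact k * sqrt pi) powr (- 1 / 2)) *
    (poly (hermite_poly k) z * exp (- z\<^sup>2 / 2))"
  by (simp only: hermite_def ladder_eq_hermite_poly)

lemma hermite_poly_ode:
  "pderiv (pderiv (hermite_poly k)) =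
    [:0, 2:] * pderiv (hermite_poly k) - smult (2 * of_nat k) (hermite_poly k)"
proof (induction k)
  case (Suc k)
  let ?p = "hermite_poly k"
  have d: "pderiv (hermite_poly (Suc k)) = smult (2 * of_nat (Suc k)) ?p"
    by (simp add: pderiv_diff pderiv_mult pderiv_pCons pderiv_smult Suc algebra_simps smult_add_left)
  show ?case
    unfolding d pderiv_smult by (simp add: algebra_simps smult_add_left smult_add_right smult_diff_right)
qed simp

lemma hermite_has_field_derivative:
  "\<exists>h'. \<forall>z. (hermite k has_field_derivative h' z) (at z) \<and>
    (h' has_field_derivative (z\<^sup>2 - 1 - 2 * of_nat k) * hermite k z) (at z)"
proof -
  let ?c = "complex_of_real ((2 ^ k * fact k * sqrt pi) powr (- 1 / 2))"
  let ?p = "hermite_poly k"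
  let ?q = "pderiv ?p - [:0, 1:] * ?p"
  have h: "hermite k = (\<lambda>z. ?c * (poly ?p z * exp (- z\<^sup>2 / 2)))"
    by (rule ext) (rule hermite_eq_poly)
  have "(hermite k has_field_derivative ?c * (poly ?q z * exp (- z\<^sup>2 / 2))) (at z)" for z
    unfolding h by (rule DERIV_cmult[OF poly_gauss_has_field_derivative])
  moreover have "((\<lambda>z. ?c * (poly ?q z * exp (- z\<^sup>2 / 2))) has_field_derivative
      (z\<^sup>2 - 1 - 2 * of_nat k) * hermite k z) (at z)" for z
  proof -
    have "poly (pderiv ?q - [:0, 1:] * ?q) z = (z\<^sup>2 - 1 - 2 * of_nat k) * poly ?p z"
      by (simp add: pderiv_diff pderiv_mult pderiv_pCons hermite_poly_ode power2_eq_square algebra_simps)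
    then show ?thesis
      using DERIV_cmult[OF poly_gauss_has_field_derivative[of ?q z], of ?c]
      unfolding hermite_eq_poly by (simp add: mult_ac)
  qed
  ultimately show ?thesis by (intro exI allI conjI)
qed

lemma hypoelliptic_laplacian_eigfun:
  "hypoelliptic_laplacian b (eigfun b n k) z = of_real (eigval b n k) * eigfun b n k z"
proof -
  obtain x y where z: "z = (x, y)" by (cases z)
  obtain h' where h: "\<And>z. (hermite k has_field_derivative h' z) (at z)"
    and h': "\<And>z. (h' has_field_derivative (z\<^sup>2 - 1 - 2 * of_nat k) * hermite k z) (at z)"
    using hermite_has_field_derivative[of k] by blast
  let ?e = "\<lambda>x. complex_of_real (1 / (2 * pi)) * exp (\<i> * of_int n * of_real x)"
  let ?w = "\<lambda>y. complex_of_real y - \<i> * of_real b * of_int n"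
  have shift: "((\<lambda>s. g (?w s)) has_vector_derivative g') (at y)"
    if "(g has_field_derivative g') (at (?w y))" for g g' y
  proof -
    have "((\<lambda>s. ?w s) has_vector_derivative 1) (at y)"
      by (auto intro!: derivative_eq_intros)
    from field_vector_diff_chain_at[OF this that] show ?thesis
      by (simp add: o_def)
  qed
  have y1: "vector_derivative (\<lambda>r. eigfun b n k (x, r)) (at s) = ?e x * h' (?w s)" for s
    unfolding eigfun_def prod.case
    by (intro vector_derivative_at has_vector_derivative_mult_right shift h)
  have y2: "vector_derivative (\<lambda>s. ?e x * h' (?w s)) (at y) =
      ?e x * (((?w y)\<^sup>2 - 1 - 2 * of_nat k) * hermite k (?w y))"
    by (intro vector_derivative_at has_vector_derivative_mult_right shift h')
  have x1: "vector_derivative (\<lambda>s. eigfun b n k (s, y)) (at x) =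
      \<i> * of_int n * eigfun b n k (x, y)"
  proof -
    have "((\<lambda>s. complex_of_real (1 / (2 * pi)) * exp (\<i> * of_int n * s) * hermite k (?w y))
        has_field_derivative \<i> * of_int n * (?e x * hermite k (?w y))) (at (of_real x))"
      by (auto intro!: derivative_eq_intros)
    from vector_derivative_at[OF has_vector_derivative_real_field[OF this]] show ?thesis
      unfolding eigfun_def prod.case .
  qed
  show ?thesis
    unfolding z hypoelliptic_laplacian_def prod.case y1 y2 x1
    by (simp add: eigfun_def eigval_def power2_eq_square field_simps)
qed

lemma integrable_poly_gauss:
  fixes p :: "complex poly"
  shows "integrable lborel (\<lambda>y. poly p (of_real y) * of_real (exp (- y\<^sup>2)))"
proof -
  have "integrable lborel (\<lambda>y::real. y ^ i * exp (- y\<^sup>2))" for i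
  proof -
    have nd: "normal_density 0 (1 / sqrt 2) y = exp (- y\<^sup>2) / sqrt pi" for y
      by (simp add: normal_density_def power_divide)
    have "integrable lborel (\<lambda>y. normal_density 0 (1 / sqrt 2) y * (y - 0) ^ i)"
      by (rule integrable_normal_moment) simp
    from integrable_mult_right[OF this, of "sqrt pi"] show ?thesis
      by (simp add: nd mult.commute)
  qed
  then have "integrable lborel (\<lambda>y::real. coeff p i * complex_of_real (y ^ i * exp (- y\<^sup>2)))" for i
    by (intro integrable_mult_right integrable_of_real)
  then have "integrable lborel
      (\<lambda>y::real. \<Sum>i\<le>degree p. coeff p i * complex_of_real (y ^ i * exp (- y\<^sup>2)))"
    by (intro Bochner_Integration.integrable_sum)
  then show ?thesis
    by (simp add: poly_altdef sum_distrib_right mult.assoc)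
qed

lemma sq_integrable_eigfun: "sq_integrable (eigfun b n k)"
proof -
  let ?f = "\<lambda>x. complex_of_real (1 / (2 * pi)) * exp (\<i> * of_int n * of_real x)"
  let ?g = "\<lambda>y. hermite k (of_real y - \<i> * of_real b * of_int n)"
  have g_cont: "continuous_on UNIV ?g"
    unfolding hermite_eq_poly by (intro continuous_intros) auto
  have [measurable]: "?f \<in> borel_measurable (restrict_space lborel {0..2 * pi})"
    by (intro measurable_restrict_space1) 
      (auto intro!: borel_measurable_continuous_onI continuous_intros)
  have [measurable]: "?g \<in> borel_measurable lborel"
    using borel_measurable_continuous_onI[OF g_cont] by simp
  have meas: "eigfun b n k \<in> borel_measurable cyl"
    unfolding eigfun_def cyl_def by measurable
  have g_int: "integrable lborel (\<lambda>y. (cmod (?g y))\<^sup>2)"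
  proof -
    let ?\<beta> = "b * of_int n"
    let ?C = "((2 ^ k * fact k * sqrt pi) powr (- 1 / 2))\<^sup>2 * exp (?\<beta>\<^sup>2)"
    define p where "p = hermite_poly k \<circ>\<^sub>p [:- \<i> * of_real b * of_int n, 1:]"
    have "(cmod (?g y))\<^sup>2 = ?C * cmod (poly (p * p) (of_real y) * of_real (exp (- y\<^sup>2)))" for y
    proof -
      let ?w = "of_real y - \<i> * of_real b * of_int n"
      have "Re (- ?w\<^sup>2 / 2) = (?\<beta>\<^sup>2 - y\<^sup>2) / 2"
        by (simp add: power2_eq_square field_simps)
      then have "(cmod (exp (- ?w\<^sup>2 / 2)))\<^sup>2 = exp (?\<beta>\<^sup>2) * exp (- y\<^sup>2)"
        by (simp only: norm_exp_eq_Re flip: exp_double exp_add) simp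
      moreover have "poly (hermite_poly k) ?w = poly p (of_real y)"
        by (simp add: p_def poly_pcompose)
      ultimately show ?thesis
        unfolding hermite_eq_poly
        by (simp add: norm_mult power_mult_distrib) (simp add: power2_eq_square)
    qed
    then show ?thesis
      using integrable_poly_gauss[of "p * p"] by (simp only: integrable_norm integrable_mult_right)
  qed
  interpret A: sigma_finite_measure "restrict_space lborel {0..2 * pi}"
    by (rule sigma_finite_measure_restrict_space) (auto simp: lborel.sigma_finite_measure_axioms)
  interpret P: pair_sigma_finite "restrict_space lborel {0..2 * pi}" "lborel :: real measure" ..
  have norm_f: "cmod (?f x) = 1 / (2 * pi)" for x
    by (simp add: norm_mult norm_divide)
  have "integrable cyl (\<lambda>z. (cmod (eigfun b n k z))\<^sup>2)"
    unfolding cyl_def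
  proof (rule P.Fubini_integrable)
    show "(\<lambda>z. (cmod (eigfun b n k z))\<^sup>2) \<in>
        borel_measurable (restrict_space lborel {0..2 * pi} \<Otimes>\<^sub>M lborel)"
      using meas unfolding cyl_def by measurable
    have eq: "(cmod (eigfun b n k (x, y)))\<^sup>2 = (1 / (2 * pi))\<^sup>2 * (cmod (?g y))\<^sup>2" for x y
      unfolding eigfun_def prod.case norm_mult[of "?f x"] norm_f power_mult_distrib ..
    show "AE x in restrict_space lborel {0..2 * pi}.
        integrable lborel (\<lambda>y. (cmod (eigfun b n k (x, y)))\<^sup>2)"
      unfolding eq using g_int by (intro AE_I2 integrable_mult_right)
    have "emeasure (restrict_space lborel {0..2 * pi}) {0..2 * pi} < \<infinity>"
      by (simp add: emeasure_restrict_space)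
    then show "integrable (restrict_space lborel {0..2 * pi})
        (\<lambda>x. LINT y|lborel. norm ((cmod (eigfun b n k (x, y)))\<^sup>2))"
      unfolding eq by (intro finite_measure.integrable_const finite_measureI)
        (simp add: space_restrict_space)
  qed
  with meas show ?thesis by (simp add: sq_integrable_def)
qed

lift_definition eig :: "real \<Rightarrow> int \<Rightarrow> nat \<Rightarrow> L2" is eigfun
  by (simp add: L2_rel_def sq_integrable_eigfun)


section \<open>The operator $e^{-tL_b}$\<close>

text \<open>
  The exponential is specified by its action on the eigenfunctions, for arbitrary complex $t$; that
  these are eigenfunctions of $L_b$ is \<open>hypoelliptic_laplacian_eigfun\<close>.
  The relation below is the graph of the resulting operator on their span.
\<close>

definition span_graph :: "real \<Rightarrow> complex \<Rightarrow> (L2 \<times> L2) set"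
  where "span_graph b t =
    {(\<Sum>(n, k)\<in>I. \<alpha> n k *\<^sub>C eig b n k,
      \<Sum>(n, k)\<in>I. (exp (- t * of_real (eigval b n k)) * \<alpha> n k) *\<^sub>C eig b n k) |
      I \<alpha>. finite I}"

definition exp_hypoelliptic :: "real \<Rightarrow> complex \<Rightarrow> (L2 \<times> L2) set"
  where "exp_hypoelliptic b t = closure (span_graph b t)"

text \<open>
  A relation on the Hilbert space is a bounded operator if it is the graph of an everywhere defined,
  complex linear, norm-bounded map. Since the eigenfunctions span a dense subspace, for the graph
  closure this says that the operator on the span extends to a bounded operator on the whole space.
\<close>

definition is_bounded_operator :: "(L2 \<times> L2) set \<Rightarrow> bool"
  where "is_bounded_operator G \<longleftrightarrow>
    (\<exists>T. bounded_linear T \<and> (\<forall>c u. T (c *\<^sub>C u) = c *\<^sub>C T u) \<and> G = {(u, T u) | u. True})"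

definition R_fun :: "complex \<Rightarrow> real"
  where "R_fun t = Re t / 2 - (cosh (Re t) - cos (Im t)) / sinh (Re t)"

end

theory Submission
  imports Defs
begin

text \<open>
  For fixed $n$ put $\beta = bn$, $w = e^{-t}$ and $\gamma = 2i\beta(1-w)$. Since
  $H_k(y-i\beta) = \sum_m {k \choose m} (-2i\beta)^{k-m} H_m(y)$, the functions
  $f_{\beta,k}$ are finite combinations of the orthogonal family
  $e^{in(x+by)} H_m(y) e^{-y^2/2}$. Identifying $H_m$ with the monomial $z^m$ turns $f_{\beta,k}$
  into a multiple of $(z-2i\beta)^k$, the $L^2$ norm into the Fock norm
  $\|z^m\|^2 = 2^m m!$, and $e^{-tL_b}$ into $p(z) \mapsto e^{-t\beta^2/2} p(wz+\gamma)$.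

  A weighted Cauchy--Schwarz inequality shows that $p \mapsto p(wz+\gamma)$ has squared norm at most
  $\exp(|\gamma|^2/(2(1-|w|^2)))$ if $|w|<1$, and truncated exponentials $e^{sz}$ show that this is
  optimal. As $|\gamma|^2 = 4\beta^2|1-w|^2$, the squared norm of the $n$-th mode is
  $\exp(-2\beta^2R(t))$, which is bounded in $n$ if and only if $R(t) \ge 0$.
  If $|w| = 1$, the truncated exponentials force $\gamma = 0$, that is, $w = 1$.
\<close>

section \<open>Affine substitutions on the Fock space\<close>

text \<open>The shift gamma is the one for which \<open>z = 2 i beta\<close> is the fixed point of
  \<open>w z + gamma\<close>; this is why every power of \<open>z - 2 i beta\<close> is an
  eigenvector of the substitution. For nonzero beta these powers are not orthogonal, so eigenvalues
  alone do not control the norm; in the orthogonal basis of monomials the whole deviation from a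
  diagonal operator sits in gamma. Modes with different n are orthogonal, so boundedness means a
  bound that is uniform in n. The mode n = 0 has gamma = 0. It excludes |w| > 1, and for |w| <= 1 it
  has norm 1, so the operator is a contraction as soon as it is bounded; the sufficiency proof
  therefore works with the constant 1 only. Bounds on the span are not enough: the graph closure
  must also be everywhere defined. This needs completeness of the quotient space \<open>L2\<close>
  and density of the span. Density reduces to showing that a function orthogonal to all modes
  vanishes almost everywhere, which is derived from the uniqueness of characteristic functions, one
  coordinate at a time.\<close>

definition fock_norm :: "complex poly \<Rightarrow> real"
  where "fock_norm p = (\<Sum>m\<le>degree p. (cmod (coeff p m))\<^sup>2 * (2 ^ m * fact m))"

lemma fock_norm_eq_sum:
  assumes "degree p \<le> N"
  shows "fock_norm p = (\<Sum>m\<le>N. (cmod (coeff p m))\<^sup>2 * (2 ^ m * fact m))"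
  unfolding fock_norm_def
  by (rule sum.mono_neutral_left) (use assms in \<open>auto simp: coeff_eq_0\<close>)

text \<open>A cut-off \<open>N\<close> below the degree is the point: coefficientwise limits can be
  taken in a finite sum while the degrees of the polynomials tend to infinity.\<close>

lemma sum_le_fock_norm:
  "(\<Sum>m\<le>N. (cmod (coeff p m))\<^sup>2 * (2 ^ m * fact m)) \<le> fock_norm p"
  unfolding fock_norm_eq_sum[of p "max N (degree p)", simplified]
  by (rule sum_mono2) auto

lemma fock_norm_nonneg: "0 \<le> fock_norm p"
  unfolding fock_norm_def by (rule sum_nonneg) auto

text \<open>Quadratic in \<open>c\<close>: despite its name, \<open>fock_norm\<close> is the square
  of a norm.\<close>

lemma fock_norm_smult: "fock_norm (smult c p) = (cmod c)\<^sup>2 * fock_norm p"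
  using fock_norm_eq_sum[of "smult c p" "degree p"] fock_norm_eq_sum[of p "degree p"]
  by (simp add: norm_mult power_mult_distrib sum_distrib_left mult.assoc)

lemma pcompose_eq_sum:
  fixes p q :: "'a::comm_ring_1 poly"
  assumes "degree p \<le> N"
  shows "pcompose p q = (\<Sum>m\<le>N. smult (coeff p m) (q ^ m))"
proof -
  have "pcompose (monom c m) q = smult c (q ^ m)" for c :: 'a and m
    by (induction m) (simp_all add: monom_0 monom_Suc pcompose_pCons)
  then have "pcompose (\<Sum>m\<le>N. monom (coeff p m) m) q = (\<Sum>m\<le>N. smult (coeff p m) (q ^ m))"
    by (simp add: pcompose_sum)
  then show ?thesis
    by (simp add: poly_as_sum_of_monoms'[OF assms])
qed

lemma coeff_pcompose_linear:
  fixes p :: "'a::comm_ring_1 poly"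
  assumes "degree p \<le> N"
  shows "coeff (pcompose p [:g, w:]) j =
    (\<Sum>m\<le>N. coeff p m * (of_nat (m choose j) * w ^ j * g ^ (m - j)))"
proof -
  have "coeff ([:g, w:] ^ m) j = of_nat (m choose j) * w ^ j * g ^ (m - j)" for m
    by (cases "j \<le> m") (auto simp: coeff_linear_poly_power coeff_eq_0 binomial_eq_0
        intro!: coeff_eq_0 le_less_trans[OF degree_power_le])
  then show ?thesis
    by (simp add: pcompose_eq_sum[OF assms] coeff_sum)
qed

text \<open>Cauchy-Schwarz for \<open>sqrt (d i)\<close> and \<open>sqrt (e i)\<close>. The
  hypothesis on squares lets it be applied to weights made of factorials and binomials without
  taking their roots.\<close>

lemma weighted_Cauchy_Schwarz:
  fixes c d e :: "'a \<Rightarrow> real"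
  assumes "\<And>i. i \<in> A \<Longrightarrow> (c i)\<^sup>2 \<le> d i * e i" "\<And>i. i \<in> A \<Longrightarrow> 0 \<le> d i" "\<And>i. i \<in> A \<Longrightarrow> 0 \<le> e i"
  shows "(\<Sum>i\<in>A. c i)\<^sup>2 \<le> (\<Sum>i\<in>A. d i) * (\<Sum>i\<in>A. e i)"
proof -
  have "\<bar>\<Sum>i\<in>A. c i\<bar> \<le> (\<Sum>i\<in>A. sqrt (d i) * sqrt (e i))"
    by (rule order_trans[OF sum_abs sum_mono])
      (metis assms(1) real_sqrt_abs real_sqrt_le_mono real_sqrt_mult)
  then have "(\<Sum>i\<in>A. c i)\<^sup>2 \<le> (\<Sum>i\<in>A. sqrt (d i) * sqrt (e i))\<^sup>2"
    by (metis abs_ge_zero power2_abs power_mono)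
  also have "\<dots> \<le> (\<Sum>i\<in>A. (sqrt (d i))\<^sup>2) * (\<Sum>i\<in>A. (sqrt (e i))\<^sup>2)"
    by (rule Cauchy_Schwarz_ineq_sum)
  finally show ?thesis using assms by (simp cong: sum.cong)
qed

lemma sum_power_div_fact_le_exp:
  fixes x :: real
  assumes "0 \<le> x"
  shows "(\<Sum>i\<le>n. x ^ i / fact i) \<le> exp x"
proof -
  have "(\<Sum>i\<le>n. x ^ i /\<^sub>R fact i) \<le> (\<Sum>i. x ^ i /\<^sub>R fact i)"
    by (rule sum_le_suminf[OF summable_exp_generic]) (use assms in auto)
  then show ?thesis by (simp add: exp_def field_simps)
qed

text \<open>Cauchy-Schwarz splits the square of each coefficient of the image into two sums over
  \<open>m\<close>. The first is a partial sum of the exponential series at \<open>x\<close>,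
  bounded independently of the row \<open>j\<close>. The second carries the binomial probability of
  \<open>j\<close> successes in \<open>m\<close> trials with parameter \<open>v\<close>, so adding
  up the rows returns \<open>fock_norm p\<close>.\<close>

lemma fock_norm_pcompose_le:
  assumes w: "cmod w < 1"
  shows "fock_norm (pcompose p [:g, w:]) \<le>
    exp ((cmod g)\<^sup>2 / (2 * (1 - (cmod w)\<^sup>2))) * fock_norm p"
proof -
  define v where "v = (cmod w)\<^sup>2"
  \<comment> \<open>With this value |g|^(2r) = x^r 2^r (1 - v)^r. The power of \<open>1 - v\<close>
    completes \<open>v ^ j\<close> to a binomial weight, and 2^r raises 2^j to the weight 2^m of the
    source.\<close>
  define x where "x = (cmod g)\<^sup>2 / (2 * (1 - v))"
  have v: "0 \<le> v" "v < 1"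
    using w by (simp_all add: v_def power_less_one_iff)
  then have x0: "0 \<le> x" by (simp add: x_def)
  let ?N = "degree p"
  let ?e = "\<lambda>m j. (cmod (coeff p m))\<^sup>2 * (2 ^ m * fact m) * (real (m choose j) * v ^ j * (1 - v) ^ (m - j))"
  have deg: "degree (pcompose p [:g, w:]) \<le> ?N"
    by (rule order_trans[OF degree_pcompose_le]) auto
  have row: "(cmod (coeff (pcompose p [:g, w:]) j))\<^sup>2 * (2 ^ j * fact j) \<le> exp x * (\<Sum>m\<le>?N. ?e m j)"
    if "j \<le> ?N" for j
  proof -
    let ?c = "\<lambda>m. cmod (coeff p m) * (real (m choose j) * cmod w ^ j * cmod g ^ (m - j))"
    have "cmod (coeff (pcompose p [:g, w:]) j) \<le> (\<Sum>m\<le>?N. ?c m)"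
      unfolding coeff_pcompose_linear[OF order_refl]
      by (rule order_trans[OF norm_sum]) (simp add: norm_mult norm_power)
    also have "\<dots> = (\<Sum>m\<in>{j..?N}. ?c m)"
      by (rule sum.mono_neutral_right) (auto simp: binomial_eq_0)
    finally have "(cmod (coeff (pcompose p [:g, w:]) j))\<^sup>2 * (2 ^ j * fact j) \<le>
        (\<Sum>m\<in>{j..?N}. ?c m)\<^sup>2 * (2 ^ j * fact j)"
      by (intro mult_right_mono power_mono) auto
    also have "\<dots> = (\<Sum>m\<in>{j..?N}. ?c m * sqrt (2 ^ j * fact j))\<^sup>2"
      by (simp add: sum_distrib_right[symmetric] power_mult_distrib)
    \<comment> \<open>The weights are chosen such that summing \<open>?e m j\<close> over \<open>j\<close> produces $(v + (1 - v))^m = 1$.\<close>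
    also have "\<dots> \<le> (\<Sum>m\<in>{j..?N}. x ^ (m - j) / fact (m - j)) * (\<Sum>m\<in>{j..?N}. ?e m j)"
    proof (rule weighted_Cauchy_Schwarz)
      fix m assume "m \<in> {j..?N}"
      then have m: "j \<le> m" by simp
      obtain r where r: "m = j + r" using m by (auto simp: le_iff_add)
      have b: "real (m choose j) = fact m / (fact j * fact r)"
        using binomial_fact[OF m, where 'a=real] r by simp
      have x: "x ^ r * (2 ^ r * (1 - v) ^ r) = ((cmod g) ^ r)\<^sup>2"
        using v by (simp add: x_def flip: power_mult_distrib power_mult) (simp add: mult.commute power_mult)
      have "(?c m * sqrt (2 ^ j * fact j))\<^sup>2 =
          (cmod (coeff p m))\<^sup>2 * real (m choose j) * v ^ j * ((cmod g) ^ r)\<^sup>2 * 2 ^ j * (real (m choose j) * fact j)"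
        by (simp add: power_mult_distrib v_def r power2_eq_square power_mult mult_ac)
      also have "\<dots> = x ^ (m - j) / fact (m - j) * ?e m j"
        unfolding x[symmetric] by (simp add: b[unfolded r] r power_add field_simps)
      finally show "(?c m * sqrt (2 ^ j * fact j))\<^sup>2 \<le> x ^ (m - j) / fact (m - j) * ?e m j" by simp
    qed (use v x0 in auto)
    also have "\<dots> \<le> exp x * (\<Sum>m\<in>{j..?N}. ?e m j)"
    proof (rule mult_right_mono)
      have "(\<Sum>m\<in>{j..?N}. x ^ (m - j) / fact (m - j)) = (\<Sum>i\<le>?N - j. x ^ i / fact i)"
        by (rule sum.reindex_bij_witness[of _ "\<lambda>i. i + j" "\<lambda>m. m - j"]) (use that in auto)
      then show "(\<Sum>m\<in>{j..?N}. x ^ (m - j) / fact (m - j)) \<le> exp x"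
        using sum_power_div_fact_le_exp[OF x0] by simp
      show "0 \<le> (\<Sum>m\<in>{j..?N}. ?e m j)" by (rule sum_nonneg) (use v in auto)
    qed
    also have "(\<Sum>m\<in>{j..?N}. ?e m j) = (\<Sum>m\<le>?N. ?e m j)"
      by (rule sum.mono_neutral_left) (auto simp: binomial_eq_0)
    finally show ?thesis .
  qed
  have "fock_norm (pcompose p [:g, w:]) \<le> (\<Sum>j\<le>?N. exp x * (\<Sum>m\<le>?N. ?e m j))"
    unfolding fock_norm_eq_sum[OF deg] by (rule sum_mono) (simp add: row)
  also have "\<dots> = exp x * (\<Sum>m\<le>?N. \<Sum>j\<le>?N. ?e m j)"
    unfolding sum_distrib_left[of "exp x", symmetric] by (subst sum.swap) (rule refl)
  also have "(\<Sum>m\<le>?N. \<Sum>j\<le>?N. ?e m j) = fock_norm p"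
    unfolding fock_norm_def
  proof (rule sum.cong[OF refl])
    fix m assume m: "m \<in> {..?N}"
    have "(\<Sum>j\<le>?N. real (m choose j) * v ^ j * (1 - v) ^ (m - j)) =
        (\<Sum>j\<le>m. real (m choose j) * v ^ j * (1 - v) ^ (m - j))"
      by (rule sum.mono_neutral_right) (use m in \<open>auto simp: binomial_eq_0\<close>)
    also have "\<dots> = 1"
      using binomial_ring[of v "1 - v" m] by simp
    finally show "(\<Sum>j\<le>?N. ?e m j) = (cmod (coeff p m))\<^sup>2 * (2 ^ m * fact m)"
      by (simp add: sum_distrib_left[symmetric])
  qed
  finally show ?thesis by (simp add: x_def v_def)
qed

text \<open>On entire functions the substitution sends e^(sz) to e^(sg) e^(swz), and the squared
  Fock norm of e^(sz) is exp(2|s|^2). As the hypothesis concerns polynomials, two limits are taken: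
  first in the degree \<open>N\<close> of the truncation, with only the coefficients up to
  \<open>J\<close> retained, then in \<open>J\<close>. The estimate holds for every
  \<open>w\<close>, so it also covers |w| >= 1.\<close>

lemma fock_norm_pcompose_bound_imp:
  assumes K: "\<And>p. fock_norm (pcompose p [:g, w:]) \<le> K * fock_norm p"
    and K0: "0 \<le> K"
  shows "exp (2 * Re (s * g) + 2 * (cmod (s * w))\<^sup>2) \<le> K * exp (2 * (cmod s)\<^sup>2)"
proof -
  define p where "p N = (\<Sum>m\<le>N. monom (s ^ m / fact m) m)" for N
  have coeff_p: "coeff (p N) m = (if m \<le> N then s ^ m / fact m else 0)" for N m
    by (auto simp: p_def coeff_sum)
  have deg: "degree (p N) \<le> N" for N
    by (rule degree_le) (simp add: coeff_p)
  have fp: "fock_norm (p N) \<le> exp (2 * (cmod s)\<^sup>2)" for N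
  proof -
    have "fock_norm (p N) = (\<Sum>m\<le>N. (2 * (cmod s)\<^sup>2) ^ m / fact m)"
      unfolding fock_norm_eq_sum[OF deg] coeff_p
      by (rule sum.cong) (auto simp: norm_divide norm_power power_mult_distrib power2_eq_square field_simps)
    then show ?thesis using sum_power_div_fact_le_exp[of "2 * (cmod s)\<^sup>2" N] by simp
  qed
  have lim: "(\<lambda>N. coeff (pcompose (p N) [:g, w:]) j) \<longlonglongrightarrow> (s * w) ^ j / fact j * exp (s * g)" for j
  \<comment> \<open>After the index shift the contributing terms are \<open>m = j + r\<close> with
    \<open>r\<close> up to \<open>N\<close>, so the coefficient is a fixed factor times a partial
    sum of the series of \<open>exp (s * g)\<close>.\<close>
  proof (rule LIMSEQ_offset[of _ j])
    have "coeff (pcompose (p (N + j)) [:g, w:]) j = (s * w) ^ j / fact j * (\<Sum>r\<le>N. (s * g) ^ r /\<^sub>R fact r)" for N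
    proof -
      have "coeff (pcompose (p (N + j)) [:g, w:]) j =
          (\<Sum>m\<le>N+j. s ^ m / fact m * (of_nat (m choose j) * w ^ j * g ^ (m - j)))"
        unfolding coeff_pcompose_linear[OF deg] by (rule sum.cong) (auto simp: coeff_p)
      also have "\<dots> = (\<Sum>m\<in>{j..N+j}. s ^ m / fact m * (of_nat (m choose j) * w ^ j * g ^ (m - j)))"
        by (rule sum.mono_neutral_right) (auto simp: binomial_eq_0)
      also have "\<dots> = (\<Sum>r\<le>N. (s * w) ^ j / fact j * ((s * g) ^ r /\<^sub>R fact r))"
      proof (rule sum.reindex_bij_witness[of _ "\<lambda>r. r + j" "\<lambda>m. m - j"])
        fix m assume m: "m \<in> {j..N + j}"
        then obtain r where r: "m = j + r" by (auto simp: le_iff_add)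
        have b: "(of_nat (m choose j) :: complex) = fact m / (fact j * fact r)"
          using binomial_fact[of j m, where 'a=complex] r by simp
        show "(s * w) ^ j / fact j * ((s * g) ^ (m - j) /\<^sub>R fact (m - j)) =
            s ^ m / fact m * (of_nat (m choose j) * w ^ j * g ^ (m - j))"
          unfolding b by (simp add: r power_add power_mult_distrib scaleR_conv_of_real field_simps)
      qed auto
      finally show ?thesis by (simp add: sum_distrib_left)
    qed
    moreover have "(\<lambda>N. \<Sum>r\<le>N. (s * g) ^ r /\<^sub>R fact r) \<longlonglongrightarrow> exp (s * g)"
      using exp_converges[of "s * g"] by (simp add: sums_def_le)
    ultimately show "(\<lambda>N. coeff (pcompose (p (N + j)) [:g, w:]) j) \<longlonglongrightarrow> (s * w) ^ j / fact j * exp (s * g)"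
      by (simp only: tendsto_mult_left)
  qed
  have "(cmod (exp (s * g)))\<^sup>2 * (\<Sum>j\<le>J. (2 * (cmod (s * w))\<^sup>2) ^ j /\<^sub>R fact j) \<le> K * exp (2 * (cmod s)\<^sup>2)" for J
  proof -
    have "(\<lambda>N. \<Sum>j\<le>J. (cmod (coeff (pcompose (p N) [:g, w:]) j))\<^sup>2 * (2 ^ j * fact j))
        \<longlonglongrightarrow> (\<Sum>j\<le>J. (cmod ((s * w) ^ j / fact j * exp (s * g)))\<^sup>2 * (2 ^ j * fact j))"
      by (intro tendsto_intros lim)
    moreover have "(\<Sum>j\<le>J. (cmod (coeff (pcompose (p N) [:g, w:]) j))\<^sup>2 * (2 ^ j * fact j))
        \<le> K * exp (2 * (cmod s)\<^sup>2)" for N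
      using sum_le_fock_norm[of "pcompose (p N) [:g, w:]" J] K[of "p N"]
        mult_left_mono[OF fp[of N] K0] by linarith
    ultimately have "(\<Sum>j\<le>J. (cmod ((s * w) ^ j / fact j * exp (s * g)))\<^sup>2 * (2 ^ j * fact j))
        \<le> K * exp (2 * (cmod s)\<^sup>2)"
      by (intro LIMSEQ_le_const2) auto
    also have "(\<Sum>j\<le>J. (cmod ((s * w) ^ j / fact j * exp (s * g)))\<^sup>2 * (2 ^ j * fact j)) =
        (cmod (exp (s * g)))\<^sup>2 * (\<Sum>j\<le>J. (2 * (cmod (s * w))\<^sup>2) ^ j /\<^sub>R fact j)"
      unfolding sum_distrib_left
      by (rule sum.cong) (auto simp: norm_mult norm_divide norm_power power_mult_distrib power2_eq_square field_simps)
    finally show ?thesis .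
  qed
  moreover have "(\<lambda>J. (cmod (exp (s * g)))\<^sup>2 * (\<Sum>j\<le>J. (2 * (cmod (s * w))\<^sup>2) ^ j /\<^sub>R fact j))
      \<longlonglongrightarrow> (cmod (exp (s * g)))\<^sup>2 * exp (2 * (cmod (s * w))\<^sup>2)"
    using exp_converges[of "2 * (cmod (s * w))\<^sup>2"] by (intro tendsto_mult_left) (simp add: sums_def_le)
  ultimately have "(cmod (exp (s * g)))\<^sup>2 * exp (2 * (cmod (s * w))\<^sup>2) \<le> K * exp (2 * (cmod s)\<^sup>2)"
    using LIMSEQ_le_const2 by blast
  moreover have "(cmod (exp (s * g)))\<^sup>2 = exp (2 * Re (s * g))"
    by (simp only: norm_exp_eq_Re exp_double)
  ultimately show ?thesis
    by (simp only: exp_add)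
qed

section \<open>Hermite polynomials\<close>

definition gauss_int :: "complex poly \<Rightarrow> complex"
  where "gauss_int p = (LINT y|lborel. poly p (of_real y) * of_real (exp (- y\<^sup>2)))"

lemma gauss_int_add: "gauss_int (p + q) = gauss_int p + gauss_int q"
  using integrable_poly_gauss[of p] integrable_poly_gauss[of q]
  by (simp add: gauss_int_def distrib_right)

lemma gauss_int_smult: "gauss_int (smult c p) = c * gauss_int p"
  by (simp add: gauss_int_def mult.assoc)

lemma gauss_int_0 [simp]: "gauss_int 0 = 0"
  by (simp add: gauss_int_def)

lemma gauss_int_diff: "gauss_int (p - q) = gauss_int p - gauss_int q"
  using gauss_int_add[of p "- q"] gauss_int_smult[of "-1" q] by simp

lemma gauss_int_sum: "gauss_int (sum f A) = (\<Sum>i\<in>A. gauss_int (f i))"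
  by (induction A rule: infinite_finite_induct) (auto simp: gauss_int_add)

text \<open>The weight exp(-y^2) is sqrt(pi) times the normal density of standard deviation 1 / sqrt
  2, so these are normal moments.\<close>

lemma gauss_int_power:
  shows gauss_int_even_power: "gauss_int (monom 1 (2 * k)) = of_real (sqrt pi * fact (2 * k) / (4 ^ k * fact k))"
    and gauss_int_odd_power: "gauss_int (monom 1 (2 * k + 1)) = 0"
proof -
  have nd: "normal_density 0 (1 / sqrt 2) y = exp (- y\<^sup>2) / sqrt pi" for y
    by (simp add: normal_density_def power_divide)
  have g: "gauss_int (monom 1 m) = of_real (sqrt pi * (LINT y|lborel. normal_density 0 (1 / sqrt 2) y * (y - 0) ^ m))" for m
    unfolding gauss_int_def integral_mult_right_zero[symmetric] integral_complex_of_real[symmetric]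
    by (simp add: nd poly_monom mult.commute)
  show "gauss_int (monom 1 (2 * k)) = of_real (sqrt pi * fact (2 * k) / (4 ^ k * fact k))"
    unfolding g by (subst integral_normal_moment_even) (simp_all add: power_divide)
  show "gauss_int (monom 1 (2 * k + 1)) = 0"
    unfolding g by (subst integral_normal_moment_odd) simp_all
qed

text \<open>Integration by parts against exp(-y^2). By linearity monomials suffice: for even
  exponents both sides vanish by parity, for odd ones the claim is the recursion between consecutive
  even moments, so no boundary terms appear.\<close>

lemma gauss_int_by_parts: "gauss_int ([:0, 2:] * p) = gauss_int (pderiv p)"
proof -
  have m: "gauss_int ([:0, 2:] * monom 1 i) = gauss_int (pderiv (monom 1 i))" for i
  proof -
    have l: "[:0, 2:] * monom 1 i = smult 2 (monom 1 (Suc i) :: complex poly)"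
      by (simp add: monom_Suc smult_monom)
    have r: "pderiv (monom 1 i) = smult (of_nat i) (monom 1 (i - 1) :: complex poly)"
      by (simp add: pderiv_monom smult_monom)
    consider k where "i = 2 * k" | k where "i = 2 * k + 1" by (metis oddE evenE)
    then show ?thesis
    proof cases
      case (1 k)
      have "gauss_int (monom 1 (Suc i)) = 0"
        using gauss_int_odd_power[of k] 1 by simp
      \<comment> \<open>For \<open>k = 0\<close> the truncated \<open>i - 1\<close> gives the moment
        of order 0, which is not zero; the factor \<open>of_nat i\<close> removes it.\<close>
      moreover have "of_nat i * gauss_int (monom 1 (i - 1)) = 0"
        using gauss_int_odd_power[of "k - 1"] 1 by (cases k) auto
      ultimately show ?thesis
        unfolding l r gauss_int_smult by simp
    next
      case (2 k)
      have i: "Suc i = 2 * Suc k" "i - 1 = 2 * k" using 2 by auto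
      have eq: "2 * (sqrt pi * fact (2 * Suc k) / (4 ^ Suc k * fact (Suc k))) =
          real i * (sqrt pi * fact (2 * k) / (4 ^ k * fact k))"
      proof -
        have *: "2 * (P * (2 * c * (d * F)) / (4 * Q * (c * G))) = d * (P * F / (Q * G))"
          if "c \<noteq> 0" for P Q F G c d :: real
          using that by (cases "Q = 0 \<or> G = 0") (auto simp: divide_simps)
        have f: "fact (2 * Suc k) = 2 * (1 + real k) * ((1 + 2 * real k) * fact (2 * k))"
            "fact (Suc k) = (1 + real k) * fact k"
          by (simp_all add: algebra_simps)
        have "1 + real k \<noteq> 0" by linarith
        from *[OF this, of "sqrt pi" "1 + 2 * real k" "fact (2 * k)" "4 ^ k" "fact k"]
        show ?thesis
          unfolding f power_Suc using 2 by simp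
      qed
      show ?thesis
        unfolding l r gauss_int_smult unfolding i gauss_int_even_power
        using arg_cong[OF eq, of complex_of_real] by (simp only: of_real_mult of_real_numeral of_real_of_nat_eq)
    qed
  qed
  have "p = (\<Sum>i\<le>degree p. smult (coeff p i) (monom 1 i))"
    using poly_as_sum_of_monoms[of p] by (simp add: smult_monom)
  then obtain c N where p: "p = (\<Sum>i\<le>(N::nat). smult (c i) (monom 1 i))" by blast
  have "gauss_int ([:0, 2:] * p) = (\<Sum>i\<le>N. c i * gauss_int ([:0, 2:] * monom 1 i))"
    unfolding p sum_distrib_left gauss_int_sum mult_smult_right gauss_int_smult ..
  also have "\<dots> = gauss_int (pderiv p)"
    unfolding p higher_pderiv_sum[of 1, simplified] gauss_int_sum pderiv_smult gauss_int_smult m ..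
  finally show ?thesis .
qed

text \<open>The raising operator 2y - d/dy is the adjoint of d/dy for the Gaussian weight.\<close>

lemma gauss_int_hermite_Suc:
  "gauss_int (p * hermite_poly (Suc k)) = gauss_int (pderiv p * hermite_poly k)"
proof -
  have "gauss_int (p * hermite_poly (Suc k)) =
      gauss_int ([:0, 2:] * (p * hermite_poly k)) - gauss_int (p * pderiv (hermite_poly k))"
    unfolding gauss_int_diff[symmetric] by (simp add: algebra_simps)
  also have "\<dots> = gauss_int (pderiv p * hermite_poly k)"
    unfolding gauss_int_by_parts pderiv_mult gauss_int_add by (simp add: mult.commute)
  finally show ?thesis .
qed

lemma pderiv_hermite_poly_Suc:
  "pderiv (hermite_poly (Suc k)) = smult (2 * of_nat (Suc k)) (hermite_poly k)"
  by (simp add: pderiv_diff pderiv_mult pderiv_pCons pderiv_smult hermite_poly_ode algebra_simps smult_add_left)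

text \<open>Moving a raising operator to the other factor lowers both indices by one and produces a
  factor \<open>2 * of_nat (Suc l)\<close>, until an index is 0 and the derivative of a constant
  decides.\<close>

lemma gauss_int_hermite_hermite:
  "gauss_int (hermite_poly j * hermite_poly k) = (if j = k then of_real (sqrt pi * (2 ^ k * fact k)) else 0)"
proof (induction j arbitrary: k)
  case 0
  show ?case
  proof (cases k)
    case 0
    then show ?thesis using gauss_int_even_power[of 0] by (simp add: one_pCons monom_0)
  next
    case (Suc l)
    then show ?thesis using gauss_int_hermite_Suc[of 1 l] by simp
  qed
next
  case (Suc j)
  show ?case
  proof (cases k)
    case 0
    then show ?thesis using gauss_int_hermite_Suc[of 1 j] by simp
  next
    case (Suc l)
    show ?thesis
      unfolding Suc gauss_int_hermite_Suc pderiv_hermite_poly_Suc mult_smult_left gauss_int_smult Suc.IH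
      by simp
  qed
qed

lemma map_poly_cnj_hermite: "map_poly cnj (hermite_poly k) = hermite_poly k"
proof -
  have "coeff (hermite_poly k) i \<in> \<real>" for i
  proof (induction k arbitrary: i)
    case (Suc k)
    then show ?case by (cases i) (auto simp: coeff_pderiv intro!: Reals_diff Reals_mult)
  qed simp
  then show ?thesis
    by (intro poly_eqI) (simp add: coeff_map_poly Reals_cnj_iff)
qed

section \<open>Transport of Fock polynomials to Hermite expansions\<close>

lemma smult_sum_right: "smult c (sum f A) = (\<Sum>i\<in>A. smult c (f i))"
  by (induction A rule: infinite_finite_induct) (auto simp: smult_add_right)

definition hermite_sum :: "complex poly \<Rightarrow> complex poly"
  where "hermite_sum p = (\<Sum>m\<le>degree p. smult (coeff p m) (hermite_poly m))"

lemma hermite_sum_eq: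
  assumes "degree p \<le> N"
  shows "hermite_sum p = (\<Sum>m\<le>N. smult (coeff p m) (hermite_poly m))"
  unfolding hermite_sum_def
  by (rule sum.mono_neutral_left) (use assms in \<open>auto simp: coeff_eq_0\<close>)

lemma hermite_sum_add: "hermite_sum (p + q) = hermite_sum p + hermite_sum q"
  using hermite_sum_eq[of p "max (degree p) (degree q)"] hermite_sum_eq[of q "max (degree p) (degree q)"]
    hermite_sum_eq[of "p + q" "max (degree p) (degree q)"]
  by (simp add: smult_add_left sum.distrib degree_add_le_max)

lemma hermite_sum_smult: "hermite_sum (smult c p) = smult c (hermite_sum p)"
  using hermite_sum_eq[of "smult c p" "degree p"] hermite_sum_eq[of p "degree p"]
  by (simp add: smult_sum_right)

lemma hermite_sum_0 [simp]: "hermite_sum 0 = 0"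
  by (simp add: hermite_sum_def)

lemma hermite_sum_sum: "hermite_sum (sum f A) = (\<Sum>i\<in>A. hermite_sum (f i))"
  by (induction A rule: infinite_finite_induct) (auto simp: hermite_sum_add)

text \<open>Multiplication by z corresponds to the raising operator: the recursion of
  \<open>hermite_poly\<close>, extended by linearity.\<close>

lemma hermite_sum_pCons_0:
  "hermite_sum (pCons 0 p) = [:0, 2:] * hermite_sum p - pderiv (hermite_sum p)"
proof -
  have "hermite_sum (pCons 0 p) = (\<Sum>m\<le>Suc (degree p). smult (coeff (pCons 0 p) m) (hermite_poly m))"
    by (rule hermite_sum_eq) (simp add: degree_pCons_le)
  also have "\<dots> = (\<Sum>m\<le>degree p. smult (coeff p m) (hermite_poly (Suc m)))"
    by (subst sum.atMost_Suc_shift) simp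
  also have "\<dots> = [:0, 2:] * hermite_sum p - pderiv (hermite_sum p)"
    unfolding hermite_sum_def higher_pderiv_sum[of 1, simplified] hermite_poly.simps sum_distrib_left
      sum_subtractf[symmetric] pderiv_smult mult_smult_right smult_diff_right ..
  finally show ?thesis .
qed

text \<open>Adding the scalar 2s to 2y - d/dy gives 2(y + s) - d/dy, the raising operator translated
  by s. Iterating it from the constant 1 yields the translated Hermite polynomials without a
  binomial expansion.\<close>

lemma hermite_sum_shifted_power:
  "hermite_sum ([:2 * s, 1:] ^ k) = pcompose (hermite_poly k) [:s, 1:]"
proof (induction k)
  case 0
  show ?case by (simp add: hermite_sum_def pcompose_1)
next
  case (Suc k)
  have "hermite_sum ([:2 * s, 1:] ^ Suc k) =
      smult (2 * s) (hermite_sum ([:2 * s, 1:] ^ k)) + hermite_sum (pCons 0 ([:2 * s, 1:] ^ k))"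
    by (simp flip: hermite_sum_smult hermite_sum_add)
  also have "\<dots> = [:2 * s, 2:] * pcompose (hermite_poly k) [:s, 1:] - pcompose (pderiv (hermite_poly k)) [:s, 1:]"
    unfolding hermite_sum_pCons_0 Suc by (simp add: pderiv_pcompose pderiv_pCons)
  also have "\<dots> = pcompose (hermite_poly (Suc k)) [:s, 1:]"
    by (simp only: hermite_poly.simps pcompose_diff pcompose_mult) (simp add: pcompose_pCons)
  finally show ?case .
qed

text \<open>The leading coefficient of \<open>hermite_poly k\<close> is \<open>2 ^ k\<close>, so the
  top degree can be eliminated. Surjectivity puts every polynomial times a Gaussian at the disposal
  of the density argument.\<close>

lemma hermite_sum_surj: "\<exists>p. hermite_sum p = r"
proof (induction "degree r" arbitrary: r rule: less_induct)
  case less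
  have deg: "degree (hermite_poly k) \<le> k \<and> coeff (hermite_poly k) k = 2 ^ k" for k
  proof (induction k)
    case (Suc k)
    then have "degree (smult 2 (pCons 0 (hermite_poly k))) \<le> Suc k"
      by (simp add: degree_pCons_le le_trans[OF degree_pCons_le])
    moreover have "degree (pderiv (hermite_poly k)) \<le> Suc k"
      using Suc degree_pderiv[of "hermite_poly k"] by linarith
    moreover have "coeff (pderiv (hermite_poly k)) (Suc k) = 0"
      using Suc by (simp add: coeff_pderiv coeff_eq_0)
    ultimately show ?case using Suc by (auto intro: degree_diff_le)
  qed simp
  show ?case
  proof (cases "degree r = 0")
    case True
    then obtain c where "r = [:c:]" by (meson degree_eq_zeroE)
    then have "hermite_sum [:c:] = r" by (simp add: hermite_sum_def)
    then show ?thesis ..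
  next
    case False
    define k where "k = degree r"
    define r' where "r' = r - smult (coeff r k / 2 ^ k) (hermite_poly k)"
    have "degree r' \<le> k" "coeff r' k = 0"
      using deg[of k] degree_smult_le[of "coeff r k / 2 ^ k" "hermite_poly k"]
      by (auto simp: r'_def k_def intro!: degree_diff_le)
    then have "degree r' < k"
      using False k_def by (metis bot_nat_0.not_eq_extremum le_neq_implies_less leading_coeff_0_iff degree_0)
    then obtain p where p: "hermite_sum p = r'" using less k_def by blast
    have m: "hermite_sum (monom 1 k) = hermite_poly k"
      by (simp add: hermite_sum_def degree_monom_eq if_distrib[of "\<lambda>c. smult c _"] cong: if_cong)
    have "hermite_sum (p + smult (coeff r k / 2 ^ k) (monom 1 k)) = r"
      unfolding hermite_sum_add hermite_sum_smult p m r'_def by simp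
    then show ?thesis ..
  qed
qed

section \<open>Orthogonality of the modes\<close>

lemma measurable_fst_cyl [measurable]: "fst \<in> borel_measurable cyl"
  unfolding cyl_def
  by (rule measurable_compose[OF measurable_fst]) (simp add: measurable_restrict_space1)

lemma measurable_snd_cyl [measurable]: "snd \<in> borel_measurable cyl"
  unfolding cyl_def by (rule measurable_compose[OF measurable_snd]) simp

lemma space_cyl: "space cyl = {0..2 * pi} \<times> UNIV"
  by (simp add: cyl_def space_pair_measure space_restrict_space)

lemma cyl_integral_product:
  fixes f g :: "real \<Rightarrow> complex"
  assumes f: "set_integrable lborel {0..2 * pi} f" and g: "integrable lborel g"
  shows "integrable cyl (\<lambda>z. f (fst z) * g (snd z))"
    and "(LINT z|cyl. f (fst z) * g (snd z)) =
      (LINT x:{0..2 * pi}|lborel. f x) * (LINT y|lborel. g y)"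
proof -
  interpret A: sigma_finite_measure "restrict_space lborel {0..2 * pi}"
    by (rule sigma_finite_measure_restrict_space) (auto simp: lborel.sigma_finite_measure_axioms)
  interpret P: pair_sigma_finite "restrict_space lborel {0..2 * pi}" "lborel :: real measure" ..
  have f': "integrable (restrict_space lborel {0..2 * pi}) f"
    using f by (simp add: integrable_restrict_space set_integrable_def)
  note [measurable] = borel_measurable_integrable[OF f'] borel_measurable_integrable[OF g]
  show int: "integrable cyl (\<lambda>z. f (fst z) * g (snd z))"
    unfolding cyl_def
  proof (rule P.Fubini_integrable)
    show "integrable (restrict_space lborel {0..2 * pi})
        (\<lambda>x. LINT y|lborel. norm (f (fst (x, y)) * g (snd (x, y))))"
      using f' by (simp add: norm_mult)
  qed (use g in auto)
  then have "(LINT z|cyl. f (fst z) * g (snd z)) =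
      (LINT x|restrict_space lborel {0..2 * pi}. LINT y|lborel. f x * g y)"
    unfolding cyl_def by (subst P.integral_fst'[symmetric]) auto
  also have "\<dots> = (LINT x:{0..2 * pi}|lborel. f x) * (LINT y|lborel. g y)"
    by (simp add: integral_restrict_space set_lebesgue_integral_def)
  finally show "(LINT z|cyl. f (fst z) * g (snd z)) =
      (LINT x:{0..2 * pi}|lborel. f x) * (LINT y|lborel. g y)" .
qed

lemma Fourier_mode_integral:
  fixes k :: int
  shows "set_integrable lborel {0..2 * pi} (\<lambda>x. exp (\<i> * of_int k * of_real x))"
    and "(LINT x:{0..2 * pi}|lborel. exp (\<i> * of_int k * of_real x)) = (if k = 0 then 2 * of_real pi else 0)"
proof -
  show "set_integrable lborel {0..2 * pi} (\<lambda>x. exp (\<i> * of_int k * of_real x))"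
    by (intro borel_integrable_atLeastAtMost' continuous_intros)
  show "(LINT x:{0..2 * pi}|lborel. exp (\<i> * of_int k * of_real x)) = (if k = 0 then 2 * of_real pi else 0)"
  proof (cases "k = 0")
    case True
    then show ?thesis by (simp add: set_lebesgue_integral_def scaleR_conv_of_real)
  next
    case False
    have "((\<lambda>x. exp (\<i> * of_int k * of_real x) / (\<i> * of_int k)) has_vector_derivative
        exp (\<i> * of_int k * of_real x)) (at x within {0..2 * pi})" for x
    proof -
      have "((\<lambda>z. exp (\<i> * of_int k * z) / (\<i> * of_int k)) has_field_derivative
          exp (\<i> * of_int k * of_real x)) (at (of_real x))"
        using False by (auto intro!: derivative_eq_intros)
      from has_vector_derivative_real_field[OF this] show ?thesis
        by (rule has_vector_derivative_at_within)
    qed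
    then have "(LINT x:{0..2 * pi}|lborel. exp (\<i> * of_int k * of_real x)) =
        exp (\<i> * of_int k * of_real (2 * pi)) / (\<i> * of_int k) - exp (\<i> * of_int k * of_real 0) / (\<i> * of_int k)"
      unfolding set_lebesgue_integral_def
      by (intro integral_FTC_Icc continuous_intros) auto
    also have "exp (\<i> * of_int k * of_real (2 * pi)) = 1"
      using exp_integer_2pi[of "of_int k"] by (simp add: mult_ac)
    finally show ?thesis using False by simp
  qed
qed

text \<open>The phase in y is dictated by the eigenfunctions: it is the cross term of exp(-(y - i b
  n)^2 / 2). It is unimodular and cancels in Hermitian products within one mode.\<close>

definition wave_fun :: "real \<Rightarrow> int \<Rightarrow> complex poly \<Rightarrow> real \<times> real \<Rightarrow> complex"
  where "wave_fun b n r = (\<lambda>z. exp (\<i> * of_int n * of_real (fst z + b * snd z)) *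
    (poly r (of_real (snd z)) * of_real (exp (- (snd z)\<^sup>2 / 2))))"

lemma borel_measurable_poly_of_real [measurable]:
  "(\<lambda>y::real. poly p (complex_of_real y)) \<in> borel_measurable borel"
  by (intro borel_measurable_continuous_onI continuous_intros)

lemma borel_measurable_wave_fun [measurable]: "wave_fun b n r \<in> borel_measurable cyl"
  unfolding wave_fun_def by measurable

lemma integral_wave_fun_mult_cnj:
  shows "integrable cyl (\<lambda>z. wave_fun b n r z * cnj (wave_fun b m s z))" (is ?I)
    and "(LINT z|cyl. wave_fun b n r z * cnj (wave_fun b m s z)) =
      (if n = m then 2 * of_real pi * gauss_int (r * map_poly cnj s) else 0)" (is ?E)
proof -
  let ?f = "\<lambda>x. exp (\<i> * of_int (n - m) * of_real x)"
  let ?g = "\<lambda>y. exp (\<i> * of_int (n - m) * of_real (b * y)) *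
    (poly (r * map_poly cnj s) (of_real y) * of_real (exp (- y\<^sup>2)))"
  have eq: "wave_fun b n r z * cnj (wave_fun b m s z) = ?f (fst z) * ?g (snd z)" for z
  proof -
    have "exp (- (snd z)\<^sup>2 / 2) * exp (- (snd z)\<^sup>2 / 2) = exp (- (snd z)\<^sup>2)"
      by (simp flip: exp_add)
    then have e: "complex_of_real (exp (- (snd z)\<^sup>2)) =
        of_real (exp (- (snd z)\<^sup>2 / 2)) * of_real (exp (- (snd z)\<^sup>2 / 2))"
      by (simp flip: of_real_mult)
    have "exp (\<i> * of_int n * of_real (fst z + b * snd z)) * cnj (exp (\<i> * of_int m * of_real (fst z + b * snd z)))
        = ?f (fst z) * exp (\<i> * of_int (n - m) * of_real (b * snd z))"
      unfolding exp_cnj exp_add[symmetric] by (rule arg_cong[of _ _ exp]) (simp add: algebra_simps)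
    moreover have "poly (map_poly cnj s) (of_real (snd z)) = cnj (poly s (of_real (snd z)))"
      using poly_cnj[of s "of_real (snd z)"] by simp
    ultimately show ?thesis
      unfolding wave_fun_def e poly_mult complex_cnj_mult complex_cnj_complex_of_real
      by (simp add: mult_ac)
  qed
  have "integrable lborel (\<lambda>y. norm (poly (r * map_poly cnj s) (of_real y) * of_real (exp (- y\<^sup>2))))"
    by (intro integrable_norm integrable_poly_gauss)
  then have g: "integrable lborel ?g"
    by (rule Bochner_Integration.integrable_bound) (measurable, simp add: norm_mult)
  show ?I unfolding eq by (rule cyl_integral_product(1)[OF Fourier_mode_integral(1) g])
  show ?E unfolding eq cyl_integral_product(2)[OF Fourier_mode_integral(1) g] Fourier_mode_integral(2)
    by (auto simp: gauss_int_def)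
qed

lemma sq_integrable_wave_fun: "sq_integrable (wave_fun b n r)"
proof -
  have "integrable cyl (\<lambda>z. Re (wave_fun b n r z * cnj (wave_fun b n r z)))"
    by (intro integrable_Re integral_wave_fun_mult_cnj)
  then show ?thesis
    by (simp add: sq_integrable_def complex_mult_cnj cmod_power2)
qed

lift_definition wave :: "real \<Rightarrow> int \<Rightarrow> complex poly \<Rightarrow> L2" is wave_fun
  by (simp add: L2_rel_def sq_integrable_wave_fun)

section \<open>Complex scalars and norms of sums of modes\<close>

lemma scaleC_add_right: "c *\<^sub>C (u + v) = c *\<^sub>C u + c *\<^sub>C v"
  by transfer (auto simp: L2_rel_def distrib_left intro!: sq_integrable_add sq_integrable_mult)

lemma scaleC_scaleC: "c *\<^sub>C d *\<^sub>C u = (c * d) *\<^sub>C u"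
  by transfer (auto simp: L2_rel_def mult.assoc intro!: sq_integrable_mult)

lemma scaleR_eq_scaleC: "r *\<^sub>R u = of_real r *\<^sub>C u"
  by transfer (auto simp: L2_rel_def scaleR_conv_of_real intro!: sq_integrable_mult)

lemma norm_scaleC: "norm (c *\<^sub>C u) = cmod c * norm u"
  by transfer (simp add: norm_mult power_mult_distrib real_sqrt_mult)

lemma linear_scaleC: "linear (\<lambda>u. c *\<^sub>C u)"
  by (intro linearI) (simp_all add: scaleC_add_right scaleR_eq_scaleC scaleC_scaleC mult.commute)

lemma bounded_linear_scaleC: "bounded_linear (\<lambda>u. c *\<^sub>C u)"
  using linear_scaleC
  by (intro bounded_linear.intro bounded_linear_axioms.intro) (auto simp: norm_scaleC mult.commute intro!: exI[of _ "cmod c"])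

lemma scaleC_sum: "c *\<^sub>C sum f A = (\<Sum>i\<in>A. c *\<^sub>C f i)"
  by (rule linear_sum[OF linear_scaleC])

lemma wave_fun_add: "wave_fun b n (r + s) = (\<lambda>z. wave_fun b n r z + wave_fun b n s z)"
  by (simp add: wave_fun_def fun_eq_iff distrib_left distrib_right)

lemma wave_fun_smult: "wave_fun b n (smult c r) = (\<lambda>z. c * wave_fun b n r z)"
  by (simp add: wave_fun_def fun_eq_iff mult_ac)

lemma wave_add: "wave b n (r + s) = wave b n r + wave b n s"
  by transfer (simp add: wave_fun_add L2_rel_def sq_integrable_add sq_integrable_wave_fun)

lemma wave_smult: "wave b n (smult c r) = c *\<^sub>C wave b n r"
  by transfer (simp add: wave_fun_smult L2_rel_def sq_integrable_mult sq_integrable_wave_fun)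

lemma wave_0 [simp]: "wave b n 0 = 0"
  using wave_add[of b n 0 0] by simp

lemma wave_sum: "wave b n (sum f A) = (\<Sum>i\<in>A. wave b n (f i))"
  by (induction A rule: infinite_finite_induct) (auto simp: wave_add)

lemma inner_wave:
  "wave b n r \<bullet> wave b m s = (if n = m then 2 * pi * Re (gauss_int (r * map_poly cnj s)) else 0)"
proof -
  have inner: "u \<bullet> v = Re (u * cnj v)" for u v :: complex
    by (simp add: inner_complex_def)
  have "wave b n r \<bullet> wave b m s = (LINT z|cyl. Re (wave_fun b n r z * cnj (wave_fun b m s z)))"
    unfolding inner[symmetric] by transfer (rule refl)
  also have "\<dots> = Re (LINT z|cyl. wave_fun b n r z * cnj (wave_fun b m s z))"
    by (rule integral_Re[OF integral_wave_fun_mult_cnj(1)])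
  finally show ?thesis
    unfolding integral_wave_fun_mult_cnj(2) by simp
qed

text \<open>The factor 2 pi sqrt(pi) is the length of the circle times the total Gaussian mass. It
  is common to all modes and cancels in every operator bound.\<close>

lemma norm_wave_hermite_sum:
  "(norm (wave b n (hermite_sum p)))\<^sup>2 = 2 * pi * sqrt pi * fock_norm p"
proof -
  let ?h = "\<lambda>m. smult (coeff p m) (hermite_poly m)"
  have cnj: "map_poly cnj (?h m) = smult (cnj (coeff p m)) (hermite_poly m)" for m
    by (subst map_poly_smult) (simp_all add: map_poly_cnj_hermite)
  have inner: "wave b n (?h j) \<bullet> wave b n (?h k) =
      (if j = k then 2 * pi * sqrt pi * ((cmod (coeff p k))\<^sup>2 * (2 ^ k * fact k)) else 0)" for j k
  proof -
    have "gauss_int (?h j * map_poly cnj (?h k)) = coeff p j * cnj (coeff p k) *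
        (if j = k then of_real (sqrt pi * (2 ^ k * fact k)) else 0)"
      unfolding cnj mult_smult_left mult_smult_right gauss_int_smult gauss_int_hermite_hermite by simp
    also have "\<dots> = of_real (if j = k then (cmod (coeff p k))\<^sup>2 * (sqrt pi * (2 ^ k * fact k)) else 0)"
      by (simp add: complex_norm_square[symmetric])
    finally show ?thesis unfolding inner_wave by simp
  qed
  have "(norm (wave b n (hermite_sum p)))\<^sup>2 = (\<Sum>m\<le>degree p. (norm (wave b n (?h m)))\<^sup>2)"
    unfolding hermite_sum_def wave_sum
    by (rule norm_sum_Pythagorean) (auto simp: pairwise_def orthogonal_def inner)
  also have "\<dots> = 2 * pi * sqrt pi * fock_norm p"
    unfolding power2_norm_eq_inner inner fock_norm_def sum_distrib_left by simp
  finally show ?thesis .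
qed

lemma norm_sum_wave_hermite_sum:
  assumes "finite J"
  shows "(norm (\<Sum>n\<in>J. wave b n (hermite_sum (p n))))\<^sup>2 = 2 * pi * sqrt pi * (\<Sum>n\<in>J. fock_norm (p n))"
  using assms
  by (subst norm_sum_Pythagorean)
    (auto simp: pairwise_def orthogonal_def inner_wave norm_wave_hermite_sum sum_distrib_left)

section \<open>Eigenfunctions in Fock coordinates\<close>

definition eig_const :: "real \<Rightarrow> int \<Rightarrow> nat \<Rightarrow> complex"
  where "eig_const b n k = of_real (1 / (2 * pi) * (2 ^ k * fact k * sqrt pi) powr (- 1 / 2) * exp ((b * of_int n)\<^sup>2 / 2))"

lemma eig_const_nonzero: "eig_const b n k \<noteq> 0"
  by (simp add: eig_const_def)

text \<open>Expanding (y - i b n)^2 yields the phase of \<open>wave_fun\<close> and the constant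
  exp((b n)^2 / 2) stored in \<open>eig_const\<close>; the translated Hermite polynomial is
  rewritten by \<open>hermite_sum_shifted_power\<close> with s = - i b n.\<close>

lemma eigfun_eq_wave_fun:
  "eigfun b n k z = eig_const b n k *
    wave_fun b n (hermite_sum ([:2 * (- \<i> * of_real (b * of_int n)), 1:] ^ k)) z"
proof -
  obtain x y where z: "z = (x, y)" by (cases z)
  let ?\<beta> = "b * of_int n"
  have "exp (- (complex_of_real y - \<i> * of_real ?\<beta>)\<^sup>2 / 2) =
      exp (of_real (?\<beta>\<^sup>2 / 2) + (\<i> * of_int n * of_real (b * y) + of_real (- y\<^sup>2 / 2)))"
    by (rule arg_cong[of _ _ exp]) (simp add: complex_eq_iff power2_eq_square field_simps)
  then have e: "exp (- (complex_of_real y - \<i> * of_real ?\<beta>)\<^sup>2 / 2) =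
      of_real (exp (?\<beta>\<^sup>2 / 2)) * (exp (\<i> * of_int n * of_real (b * y)) * of_real (exp (- y\<^sup>2 / 2)))"
    by (simp only: exp_add exp_of_real)
  have w: "complex_of_real y - \<i> * of_real b * of_int n = of_real y - \<i> * of_real ?\<beta>" by simp
  have p: "poly (pcompose (hermite_poly k) [:- \<i> * of_real ?\<beta>, 1:]) (of_real y) =
      poly (hermite_poly k) (of_real y - \<i> * of_real ?\<beta>)"
    by (simp add: poly_pcompose)
  have x: "exp (\<i> * of_int n * complex_of_real (x + b * y)) =
      exp (\<i> * of_int n * of_real x) * exp (\<i> * of_int n * of_real (b * y))"
    unfolding exp_add[symmetric] of_real_add distrib_left ..
  show ?thesis
    unfolding z eigfun_def wave_fun_def hermite_sum_shifted_power prod.case fst_conv snd_conv w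
      hermite_eq_poly e p x unfolding eig_const_def of_real_mult by (simp only: mult_ac)
qed

lemma eig_eq_wave:
  "eig b n k = eig_const b n k *\<^sub>C wave b n (hermite_sum ([:2 * (- \<i> * of_real (b * of_int n)), 1:] ^ k))"
  by transfer (simp only: eigfun_eq_wave_fun[symmetric] L2_rel_def sq_integrable_eigfun simp_thms eventually_True)

section \<open>Completeness of the modes\<close>

text \<open>Packages the law of \<open>p\<close> under the density \<open>q\<close> as a
  distribution on the line, the setting of \<open>Levy_uniqueness\<close>.\<close>

lemma distr_density_prob:
  fixes q p :: "'a \<Rightarrow> real"
  assumes q: "integrable M q" "\<And>x. 0 \<le> q x" "(LINT x|M. q x) = 1"
    and [measurable]: "p \<in> borel_measurable M"
  defines "D \<equiv> distr (density M q) borel p"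
  shows "real_distribution D"
    and "char D t = (CLINT x|M. q x *\<^sub>R iexp (t * p x))"
    and "A \<in> sets borel \<Longrightarrow> measure D A = (LINT x:(p -` A \<inter> space M)|M. q x)"
proof -
  have [measurable]: "q \<in> borel_measurable M" using q(1) by simp
  have "emeasure (density M q) (space (density M q)) = 1"
    using q nn_integral_eq_integral[of M q]
    by (simp add: emeasure_density nn_integral_set_ennreal cong: nn_integral_cong)
  then interpret Q: prob_space "density M q" by (rule prob_spaceI)
  show "real_distribution D"
    unfolding D_def by (rule Q.real_distribution_distr) simp
  show "char D t = (CLINT x|M. q x *\<^sub>R iexp (t * p x))"
    unfolding D_def char_def by (subst integral_distr) (auto simp: integral_density q)
  assume [measurable]: "A \<in> sets borel"
  have "measure D A = (LINT x|density M q. indicator (p -` A \<inter> space M) x)"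
    unfolding D_def by (simp add: measure_distr)
  also have "\<dots> = (LINT x:(p -` A \<inter> space M)|M. q x)"
    unfolding set_lebesgue_integral_def
    by (subst integral_density) (auto simp: q mult.commute)
  finally show "measure D A = (LINT x:(p -` A \<inter> space M)|M. q x)" .
qed

text \<open>At \<open>t = 0\<close> the hypothesis says that the positive and negative parts of
  \<open>g\<close> have the same mass \<open>c\<close>. Divided by \<open>c\<close>, they are
  probability densities under which \<open>p\<close> has the same characteristic function, hence the
  same law. If the mass is zero, \<open>g\<close> vanishes almost everywhere.\<close>

lemma set_integral_eq_0_if_char_eq_0_real:
  fixes g p :: "'a \<Rightarrow> real"
  assumes g: "integrable M g" and [measurable]: "p \<in> borel_measurable M"
    and char: "\<And>t. (CLINT x|M. g x *\<^sub>R iexp (t * p x)) = 0"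
    and A: "A \<in> sets borel"
  shows "(LINT x:(p -` A \<inter> space M)|M. g x) = 0"
proof -
  have [measurable]: "g \<in> borel_measurable M" "A \<in> sets borel" using g A by simp_all
  define c where "c = (LINT x|M. max 0 (g x))"
  let ?q = "\<lambda>x. max 0 (g x) / c" and ?r = "\<lambda>x. max 0 (- g x) / c"
  have int: "integrable M (\<lambda>x. max 0 (g x))" "integrable M (\<lambda>x. max 0 (- g x))"
    using g by (auto intro!: integrable_max)
  have g_eq: "g x = max 0 (g x) - max 0 (- g x)" for x by (simp add: max_def)
  have "complex_of_real (LINT x|M. g x) = 0"
    using char[of 0] by (simp add: scaleR_conv_of_real)
  then have "(LINT x|M. max 0 (g x) - max 0 (- g x)) = 0"
    unfolding g_eq[symmetric] by simp
  then have c': "c = (LINT x|M. max 0 (- g x))"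
    using int by (simp add: c_def)
  have S: "p -` A \<inter> space M \<in> sets M" by measurable
  show ?thesis
  proof (cases "c = 0")
    case True
    have "AE x in M. max 0 (g x) = 0" "AE x in M. max 0 (- g x) = 0"
      using integral_nonneg_eq_0_iff_AE[OF int(1)] integral_nonneg_eq_0_iff_AE[OF int(2)] c' True
      by (auto simp: c_def)
    then have "AE x in M. g x = 0"
      by eventually_elim (simp add: max_def split: if_splits)
    then have "(LINT x:(p -` A \<inter> space M)|M. g x) = (LINT x:(p -` A \<inter> space M)|M. 0)"
      unfolding set_lebesgue_integral_def by (intro integral_cong_AE) auto
    then show ?thesis by simp
  next
    case False
    then have c: "c > 0"
      using integral_nonneg_AE[of "\<lambda>x. max 0 (g x)" M] by (auto simp: c_def less_le)
    have int': "integrable M ?q" "integrable M ?r" using int by simp_all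
    have q: "integrable M ?q" "\<And>x. 0 \<le> ?q x" "(LINT x|M. ?q x) = 1"
      using int c by (simp_all add: c_def)
    have r: "integrable M ?r" "\<And>x. 0 \<le> ?r x" "(LINT x|M. ?r x) = 1"
      using int c by (simp_all add: c')
    have gqr: "g x = c * (?q x - ?r x)" for x
      using c by (subst g_eq) (simp add: right_diff_distrib)
    have ci: "complex_integrable M (\<lambda>x. f x *\<^sub>R iexp (t * p x))" if "integrable M f" for f t
      using that by (rule Bochner_Integration.integrable_bound) (use that in auto)
    have "(CLINT x|M. ?q x *\<^sub>R iexp (t * p x)) = (CLINT x|M. ?r x *\<^sub>R iexp (t * p x))" for t
    proof -
      have "0 = (CLINT x|M. (c * (?q x - ?r x)) *\<^sub>R iexp (t * p x))"
        using char[of t] unfolding gqr[symmetric] by simp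
      also have "\<dots> = (CLINT x|M. c *\<^sub>R (?q x *\<^sub>R iexp (t * p x) - ?r x *\<^sub>R iexp (t * p x)))"
        by (simp only: scaleR_scaleR[symmetric] scaleR_diff_left)
      also have "\<dots> = c *\<^sub>R ((CLINT x|M. ?q x *\<^sub>R iexp (t * p x)) - (CLINT x|M. ?r x *\<^sub>R iexp (t * p x)))"
        by (simp only: integral_scaleR_right Bochner_Integration.integral_diff ci int')
      finally show ?thesis using c by simp
    qed
    then have "distr (density M ?q) borel p = distr (density M ?r) borel p"
      by (intro Levy_uniqueness ext distr_density_prob(1) q r) (simp_all only: distr_density_prob(2) q r assms)
    then have "measure (distr (density M ?q) borel p) A = measure (distr (density M ?r) borel p) A"
      by (rule arg_cong)
    then have "(LINT x:(p -` A \<inter> space M)|M. ?q x) = (LINT x:(p -` A \<inter> space M)|M. ?r x)"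
      by (simp only: distr_density_prob(3)[OF q assms(2) A] distr_density_prob(3)[OF r assms(2) A])
    moreover have "set_integrable M (p -` A \<inter> space M) ?q" "set_integrable M (p -` A \<inter> space M) ?r"
      unfolding set_integrable_def using int' S by (auto intro!: integrable_mult_indicator simp del: real_scaleR_def)
    ultimately have "(LINT x:(p -` A \<inter> space M)|M. c * (?q x - ?r x)) = 0"
      by (simp only: set_integral_mult_right set_integral_diff) simp
    then show ?thesis by (simp only: gqr[symmetric])
  qed
qed

text \<open>Conjugation combined with the change from \<open>t\<close> to \<open>- t\<close> shows
  that the conjugate of \<open>g\<close> satisfies the same hypothesis. So do the real and imaginary
  parts, to which the real version applies.\<close>

lemma set_integral_eq_0_if_char_eq_0:
  fixes g :: "'a \<Rightarrow> complex" and p :: "'a \<Rightarrow> real"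
  assumes g: "integrable M g" and [measurable]: "p \<in> borel_measurable M"
    and char: "\<And>t. (CLINT x|M. g x * iexp (t * p x)) = 0"
    and A: "A \<in> sets borel"
  shows "(LINT x:(p -` A \<inter> space M)|M. g x) = 0"
proof -
  have [measurable]: "g \<in> borel_measurable M" using g by simp
  have cnj_g: "complex_integrable M (\<lambda>x. cnj (g x))" using g by simp
  have [measurable]: "(\<lambda>x. cnj (g x)) \<in> borel_measurable M"
    using cnj_g by (rule borel_measurable_integrable)
  have ci: "complex_integrable M (\<lambda>x. g x * iexp (t * p x))"
     "complex_integrable M (\<lambda>x. cnj (g x) * iexp (t * p x))" for t
    by (rule Bochner_Integration.integrable_bound[OF g] Bochner_Integration.integrable_bound[OF cnj_g];
        simp add: norm_mult)+
  have cnj: "(CLINT x|M. cnj (g x) * iexp (t * p x)) = 0" for t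
  proof -
    have "cnj (g x) * iexp (t * p x) = cnj (g x * iexp (- t * p x))" for x
      unfolding complex_cnj_mult exp_cnj by simp
    then have "(CLINT x|M. cnj (g x) * iexp (t * p x)) = (CLINT x|M. cnj (g x * iexp (- t * p x)))"
      by (rule Bochner_Integration.integral_cong[OF refl])
    also have "\<dots> = cnj (CLINT x|M. g x * iexp (- t * p x))"
      by (rule Bochner_Integration.integral_cnj)
    finally show ?thesis unfolding char by simp
  qed
  have "(CLINT x|M. Re (g x) *\<^sub>R iexp (t * p x)) = 0" for t
  proof -
    have "Re (g x) *\<^sub>R iexp (t * p x) = (g x * iexp (t * p x) + cnj (g x) * iexp (t * p x)) / 2" for x
      by (simp add: distrib_right[symmetric] complex_add_cnj scaleR_conv_of_real)
    then show ?thesis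
      by (simp only: integral_divide_zero Bochner_Integration.integral_add[OF ci] char cnj) simp
  qed
  then have Re: "(LINT x:(p -` A \<inter> space M)|M. Re (g x)) = 0"
    by (rule set_integral_eq_0_if_char_eq_0_real[OF integrable_Re[OF g] assms(2) _ A])
  have "(CLINT x|M. Im (g x) *\<^sub>R iexp (t * p x)) = 0" for t
  proof -
    have "Im (g x) *\<^sub>R iexp (t * p x) = (g x * iexp (t * p x) - cnj (g x) * iexp (t * p x)) / (2 * \<i>)" for x
      unfolding left_diff_distrib[symmetric] complex_diff_cnj scaleR_conv_of_real
      by (subst eq_divide_eq) (simp add: mult_ac)
    then show ?thesis
      by (simp only: integral_divide_zero Bochner_Integration.integral_diff[OF ci] char cnj) simp
  qed
  then have Im: "(LINT x:(p -` A \<inter> space M)|M. Im (g x)) = 0"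
    by (rule set_integral_eq_0_if_char_eq_0_real[OF integrable_Im[OF g] assms(2) _ A])
  have "complex_integrable M (\<lambda>x. indicator (p -` A \<inter> space M) x *\<^sub>R g x)"
    using A g by (intro integrable_mult_indicator) auto
  then show ?thesis
    using Re Im unfolding set_lebesgue_integral_def by (simp add: complex_eq_iff flip: integral_Re integral_Im)
qed

text \<open>Dynkin's argument for the vector measure with density \<open>g\<close>; the total
  integral handles complements. The free map \<open>p\<close> covers both sets that depend on one
  coordinate and, as the identity, all measurable sets.\<close>

lemma set_integral_eq_0_sigma_sets:
  fixes g :: "'a \<Rightarrow> 'b::{banach, second_countable_topology}"
  assumes g: "integrable M g" and p: "p \<in> measurable M N"
    and N: "sets N = sigma_sets (space N) E" "Int_stable E" "E \<subseteq> Pow (space N)"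
    and E: "\<And>A. A \<in> E \<Longrightarrow> (LINT x:(p -` A \<inter> space M)|M. g x) = 0"
    and tot: "(LINT x|M. g x) = 0"
    and A: "A \<in> sets N"
  shows "(LINT x:(p -` A \<inter> space M)|M. g x) = 0"
proof -
  have si: "set_integrable M B g" if "B \<in> sets M" for B
    unfolding set_integrable_def using that g by (rule integrable_mult_indicator)
  have pm: "p -` A \<inter> space M \<in> sets M" if "A \<in> sets N" for A
    using p that by (rule measurable_sets)
  show ?thesis
    using N(2,3) A[unfolded N(1)]
  proof (induction rule: sigma_sets_induct_disjoint)
    case (basic A)
    then show ?case by (rule E)
  next
    case empty
    then show ?case by (simp add: set_lebesgue_integral_def)
  next
    case (compl A)
    let ?B = "p -` A \<inter> space M" and ?C = "p -` (space N - A) \<inter> space M"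
    have "?B \<inter> ?C = {}" "?B \<union> ?C = space M"
      using measurable_space[OF p] by auto
    moreover have "?B \<in> sets M" "?C \<in> sets M"
      using compl(1) by (auto intro!: pm simp: N(1)[symmetric])
    ultimately have "(LINT x|M. g x) = (LINT x:?B|M. g x) + (LINT x:?C|M. g x)"
      using set_integral_Un[of ?B ?C M g] si set_integral_space[OF g] by simp
    then show ?case using compl(2) tot by simp
  next
    case (union A)
    have "(LINT x:(\<Union>i. p -` A i \<inter> space M)|M. g x) = (\<Sum>i. LINT x:(p -` A i \<inter> space M)|M. g x)"
      using union(1,2) by (intro lebesgue_integral_countable_add si pm sets.countable_UN)
        (auto simp: N(1)[symmetric] disjoint_family_on_def intro!: pm)
    moreover have "(\<Union>i. p -` A i \<inter> space M) = p -` (\<Union>i. A i) \<inter> space M" by auto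
    ultimately show ?case using union(3) by simp
  qed
qed

lemma AE_eq_0_if_set_integral_eq_0:
  fixes g :: "'a \<Rightarrow> complex"
  assumes g: "integrable M g" and 0: "\<And>A. A \<in> sets M \<Longrightarrow> (LINT x:A|M. g x) = 0"
  shows "AE x in M. g x = 0"
proof -
  \<comment> \<open>The one-sided claim is tested on the set where \<open>f\<close> is positive; it
    is then used for the real and imaginary parts with both signs.\<close>
  have real: "AE x in M. f x \<le> 0"
    if f: "integrable M f" and 0: "\<And>A. A \<in> sets M \<Longrightarrow> (LINT x:A|M. f x) = 0" for f :: "'a \<Rightarrow> real"
  proof -
    have [measurable]: "f \<in> borel_measurable M" using f by simp
    have eq: "indicator {x \<in> space M. 0 < f x} x *\<^sub>R f x = max 0 (f x)" if "x \<in> space M" for x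
      using that by (auto simp: indicator_def max_def)
    have "(LINT x|M. max 0 (f x)) = (LINT x:{x \<in> space M. 0 < f x}|M. f x)"
      unfolding set_lebesgue_integral_def by (rule Bochner_Integration.integral_cong) (simp_all only: eq)
    also have "\<dots> = 0" by (rule 0) simp
    finally have "AE x in M. max 0 (f x) = 0"
      using f by (subst (asm) integral_nonneg_eq_0_iff_AE) auto
    then show ?thesis by eventually_elim (simp add: max_def split: if_splits)
  qed
  have si: "complex_integrable M (\<lambda>x. indicator A x *\<^sub>R g x)" if "A \<in> sets M" for A
    using that g by (intro integrable_mult_indicator)
  have Re: "(LINT x:A|M. Re (g x)) = 0" and Im: "(LINT x:A|M. Im (g x)) = 0" if "A \<in> sets M" for A
    using 0[OF that] integral_Re[OF si[OF that]] integral_Im[OF si[OF that]]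
    by (simp_all add: set_lebesgue_integral_def)
  have m: "(LINT x:A|M. - Re (g x)) = 0" "(LINT x:A|M. - Im (g x)) = 0" if "A \<in> sets M" for A
    using Re[OF that] Im[OF that] by (simp_all add: set_lebesgue_integral_def)
  have "AE x in M. Re (g x) \<le> 0" "AE x in M. - Re (g x) \<le> 0"
    "AE x in M. Im (g x) \<le> 0" "AE x in M. - Im (g x) \<le> 0"
    by (rule real; use g Re Im m in simp)+
  then show ?thesis
    by eventually_elim (simp add: complex_eq_iff)
qed

section \<open>From Fourier coefficients and polynomial moments to vanishing functions\<close>

lemma integrable_mult_sq_integrable:
  assumes "sq_integrable u" "sq_integrable v"
  shows "integrable cyl (\<lambda>z. u z * v z)"
proof -
  have [measurable]: "u \<in> borel_measurable cyl" "v \<in> borel_measurable cyl"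
    using assms by (auto simp: sq_integrable_def)
  have "cmod (a * b) \<le> norm ((cmod a)\<^sup>2 + (cmod b)\<^sup>2)" for a b :: complex
    using sum_squares_bound[of "cmod a" "cmod b"] mult_nonneg_nonneg[OF norm_ge_zero[of a] norm_ge_zero[of b]]
    unfolding norm_mult real_norm_def by linarith
  moreover have "integrable cyl (\<lambda>z. (cmod (u z))\<^sup>2 + (cmod (v z))\<^sup>2)"
    using assms by (auto simp: sq_integrable_def)
  ultimately show ?thesis
    by (elim Bochner_Integration.integrable_bound) auto
qed

text \<open>Supplies the dominating function for the passage from polynomials to exp(i c y), since
  the partial sums of that series are bounded by exp(|c| |y|).\<close>

lemma sq_integrable_exp_abs_gauss:
  "sq_integrable (\<lambda>z. complex_of_real (exp (c * \<bar>snd z\<bar> - (snd z)\<^sup>2 / 2)))"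
proof -
  have "integrable lborel (\<lambda>y. complex_of_real (sqrt (2 * pi) * std_normal_density y))"
    using integrable_std_normal_moment[of 0] by (intro integrable_of_real integrable_mult_right) simp
  then have "integrable lborel (\<lambda>y::real. complex_of_real (exp (- y\<^sup>2 / 2)))"
    by (simp add: std_normal_density_def)
  from cyl_integral_product(1)[OF Fourier_mode_integral(1)[of 0] this]
  have int: "integrable cyl (\<lambda>z. complex_of_real (exp (2 * c\<^sup>2) * exp (- (snd z)\<^sup>2 / 2)))"
    by simp
  have "(exp (c * \<bar>y\<bar> - y\<^sup>2 / 2))\<^sup>2 \<le> exp (2 * c\<^sup>2) * exp (- y\<^sup>2 / 2)" for y :: real
  proof -
    \<comment> \<open>Half of the Gaussian decay absorbs the linear term at the price of a constant;
      the other half remains for integrability.\<close>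
    have "0 \<le> (2 * c - \<bar>y\<bar>)\<^sup>2" by simp
    then have "2 * (c * \<bar>y\<bar> - y\<^sup>2 / 2) \<le> 2 * c\<^sup>2 - y\<^sup>2 / 2"
      by (simp add: power2_eq_square algebra_simps)
    then show ?thesis by (simp flip: exp_double exp_add)
  qed
  then have "integrable cyl (\<lambda>z. (exp (c * \<bar>snd z\<bar> - (snd z)\<^sup>2 / 2))\<^sup>2)"
    by (intro Bochner_Integration.integrable_bound[OF int]) (auto simp: norm_mult)
  then show ?thesis
    by (simp add: sq_integrable_def)
qed

lemma AE_fst_cyl_neq: "AE z in cyl. fst z \<noteq> a"
proof -
  interpret A: sigma_finite_measure "restrict_space lborel {0..2 * pi}"
    by (rule sigma_finite_measure_restrict_space) (auto simp: lborel.sigma_finite_measure_axioms)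
  interpret P: pair_sigma_finite "restrict_space lborel {0..2 * pi}" "lborel :: real measure" ..
  have "AE x in restrict_space lborel {0..2 * pi}. x \<noteq> a"
    by (subst AE_restrict_space_iff) (auto intro: eventually_mono[OF AE_lborel_singleton[of a]])
  then have "AE x in restrict_space lborel {0..2 * pi}. AE y in (lborel :: real measure). fst (x, y) \<noteq> a"
    by eventually_elim simp
  moreover have "{z \<in> space cyl. fst z \<noteq> a} \<in> sets cyl" by measurable
  ultimately show ?thesis
    unfolding cyl_def by (intro P.AE_pair_measure)
qed

text \<open>The arc from 0 to \<open>s\<close> consists of the points at distance less than
  \<open>s / 2\<close> from its midpoint \<open>s / 2\<close>. The last case reflects at pi, beyond
  which the cosine increases again.\<close>

lemma cos_greater_iff_arc:
  assumes x: "0 \<le> x" "x \<le> 2 * pi" and s: "0 \<le> s" "s \<le> 2 * pi"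
  shows "cos (s / 2) < cos (x - s / 2) \<longleftrightarrow> 0 < x \<and> x < s"
proof -
  consider "x = 0" | "0 < x" "x < s" | "s \<le> x" "x - s / 2 \<le> pi" | "s \<le> x" "pi < x - s / 2"
    using x by linarith
  then show ?thesis
  proof cases
    case 2
    have "cos \<bar>x - s / 2\<bar> > cos (s / 2)"
      by (rule cos_monotone_0_pi) (use 2 s in \<open>auto simp: abs_if\<close>)
    with 2 show ?thesis by simp
  next
    case 3
    have "cos (x - s / 2) \<le> cos (s / 2)"
      by (rule cos_monotone_0_pi_le) (use 3 s in auto)
    with 3 show ?thesis by simp
  next
    case 4
    have "cos (2 * pi - (x - s / 2)) \<le> cos (s / 2)"
      by (rule cos_monotone_0_pi_le) (use 4 s x in auto)
    moreover have "cos (2 * pi - (x - s / 2)) = cos (x - s / 2)"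
      by (metis cos_2pi_minus)
    ultimately show ?thesis using 4 by simp
  qed simp
qed

text \<open>
  Passing to the limit in the exponential series of a trigonometric polynomial $p$, a function all
  of whose Fourier coefficients vanish integrates to zero against $e^{itp}$, hence over all level
  sets of $p$; the shifted cosines have the arcs as level sets.
\<close>

lemma set_integral_eq_0_if_Fourier_eq_0:
  assumes g: "integrable cyl g"
    and F: "\<And>n::int. (LINT z|cyl. g z * exp (\<i> * of_int n * of_real (fst z))) = 0"
    and A: "A \<in> sets borel"
  shows "(LINT z:(fst -` A \<inter> space cyl)|cyl. g z) = 0"
proof -
  have [measurable]: "g \<in> borel_measurable cyl" using g by simp
  have int: "integrable cyl (\<lambda>z. g z * h z)"
    if "h \<in> borel_measurable cyl" "\<And>z. cmod (h z) \<le> B" for h B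
  proof (rule Bochner_Integration.integrable_bound)
    show "integrable cyl (\<lambda>z. of_real B * g z)" using g by simp
    have "0 \<le> B" using that(2)[of undefined] norm_ge_zero order_trans by blast
    then show "AE z in cyl. norm (g z * h z) \<le> norm (of_real B * g z)"
      unfolding norm_mult norm_of_real abs_of_nonneg[OF \<open>0 \<le> B\<close>]
      by (intro AE_I2) (subst mult.commute, rule mult_right_mono[OF that(2) norm_ge_zero])
  qed (use that in measurable)
  have tot: "(LINT z|cyl. g z) = 0" using F[of 0] by simp
  have arc: "(LINT z:{z \<in> space cyl. 0 < fst z \<and> fst z < s}|cyl. g z) = 0" if s: "0 \<le> s" "s \<le> 2 * pi" for s
  proof -
    let ?p = "\<lambda>z::real \<times> real. cos (fst z - s / 2)"
    \<comment> \<open>Each factor cos(x - s/2) shifts the frequency by 1 or -1, hence the arbitrary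
      \<open>n\<close> in the induction. Powers of a trigonometric polynomial involve integer
      frequencies only, whereas exp(i t x) with non-integer t would be out of reach.\<close>
    have pow: "(LINT z|cyl. g z * (exp (\<i> * of_int n * of_real (fst z)) * of_real (?p z) ^ j)) = 0" for j n
    proof (induction j arbitrary: n)
      case 0
      then show ?case using F by simp
    next
      case (Suc j)
      let ?e = "\<lambda>n z. g z * (exp (\<i> * of_int n * of_real (fst z)) * of_real (?p z) ^ j)"
      have i: "integrable cyl (?e n)" for n
        by (rule int[of _ 1]) (auto simp: norm_mult norm_power intro!: power_le_one)
      have cos: "complex_of_real (?p z) = (exp (- \<i> * of_real (s / 2)) * exp (\<i> * of_real (fst z)) +
          exp (\<i> * of_real (s / 2)) * exp (- \<i> * of_real (fst z))) / 2" for z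
        unfolding cos_of_real[symmetric] cos_exp_eq exp_add[symmetric] by (simp add: algebra_simps)
      have "g z * (exp (\<i> * of_int n * of_real (fst z)) * of_real (?p z) ^ Suc j) =
          (exp (- \<i> * of_real (s / 2)) * ?e (n + 1) z + exp (\<i> * of_real (s / 2)) * ?e (n - 1) z) / 2" for z
      proof -
        have "exp (\<i> * of_int (n + 1) * of_real (fst z)) = exp (\<i> * of_int n * of_real (fst z)) * exp (\<i> * of_real (fst z))"
          "exp (\<i> * of_int (n - 1) * of_real (fst z)) = exp (\<i> * of_int n * of_real (fst z)) * exp (- \<i> * of_real (fst z))"
          unfolding exp_add[symmetric] by (simp_all add: algebra_simps)
        then show ?thesis
          unfolding power_Suc cos[of z] by (simp only:) (simp add: algebra_simps)
      qed
      then show ?case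
        by (simp only: integral_divide_zero integral_mult_right_zero Suc
            Bochner_Integration.integral_add[OF integrable_mult_right integrable_mult_right, OF i i]) simp
    qed
    have char: "(CLINT z|cyl. g z * iexp (t * ?p z)) = 0" for t
    proof -
      let ?S = "\<lambda>N z. \<Sum>m<N. (\<i> * of_real (t * ?p z)) ^ m /\<^sub>R fact m"
      have "(\<lambda>N. LINT z|cyl. g z * ?S N z) \<longlonglongrightarrow> (CLINT z|cyl. g z * iexp (t * ?p z))"
      proof (rule integral_dominated_convergence)
        show "integrable cyl (\<lambda>z. exp \<bar>t\<bar> * norm (g z))" using g by simp
        show "AE z in cyl. (\<lambda>N. g z * ?S N z) \<longlonglongrightarrow> g z * iexp (t * ?p z)"
          using exp_converges by (intro AE_I2 tendsto_mult_left) (simp add: sums_def)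
        show "AE z in cyl. norm (g z * ?S N z) \<le> exp \<bar>t\<bar> * norm (g z)" for N
        proof (rule AE_I2)
          fix z
          have "norm (?S N z) \<le> (\<Sum>m<N. \<bar>t\<bar> ^ m /\<^sub>R fact m)"
            by (rule sum_norm_le) (auto simp: norm_mult norm_power abs_mult intro!: power_mono mult_left_le)
          also have "\<dots> \<le> exp \<bar>t\<bar>"
            unfolding exp_def by (rule sum_le_suminf[OF summable_exp_generic]) auto
          finally show "norm (g z * ?S N z) \<le> exp \<bar>t\<bar> * norm (g z)"
            by (subst norm_mult, subst mult.commute) (rule mult_right_mono[OF _ norm_ge_zero])
        qed
      qed simp_all
      moreover have "(LINT z|cyl. g z * ?S N z) = 0" for N
      proof -
        have "g z * ?S N z = (\<Sum>m<N. ((\<i> * of_real t) ^ m /\<^sub>R fact m) *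
            (g z * (exp (\<i> * of_int 0 * of_real (fst z)) * of_real (?p z) ^ m)))" for z
          by (simp add: sum_distrib_left power_mult_distrib scaleR_conv_of_real mult_ac)
        moreover have "integrable cyl (\<lambda>z. g z * (exp (\<i> * of_int 0 * of_real (fst z)) * of_real (?p z) ^ m))" for m
          by (rule int[of _ 1]) (auto simp: norm_mult norm_power intro!: power_le_one)
        ultimately show ?thesis
          by (simp only: Bochner_Integration.integral_sum integrable_mult_right integral_mult_right_zero pow) simp
      qed
      ultimately show ?thesis
        by (simp add: LIMSEQ_const_iff)
    qed
    have "(LINT z:(?p -` {cos (s / 2)<..} \<inter> space cyl)|cyl. g z) = 0"
      by (rule set_integral_eq_0_if_char_eq_0[OF g _ char]) auto
    moreover have "?p -` {cos (s / 2)<..} \<inter> space cyl = {z \<in> space cyl. 0 < fst z \<and> fst z < s}"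
      using cos_greater_iff_arc[OF _ _ s] by (auto simp: space_cyl)
    ultimately show ?thesis by simp
  qed
  \<comment> \<open>For \<open>s\<close> in [0, 2 pi] the half line differs from the open arc only
    by the null sets over 0 and \<open>s\<close>; half lines generate the Borel sets.\<close>
  have half_line: "(LINT z:(fst -` {..s} \<inter> space cyl)|cyl. g z) = 0" for s
  proof -
    consider "s < 0" | "0 \<le> s" "s \<le> 2 * pi" | "2 * pi < s" by linarith
    then show ?thesis
    proof cases
      case 1
      then have "fst -` {..s} \<inter> space cyl = {}" by (auto simp: space_cyl)
      then show ?thesis by (simp add: set_lebesgue_integral_def)
    next
      case 2
      have "AE z in cyl. z \<in> {z \<in> space cyl. 0 < fst z \<and> fst z < s} \<longleftrightarrow> z \<in> fst -` {..s} \<inter> space cyl"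
        using AE_fst_cyl_neq[of 0] AE_fst_cyl_neq[of s] AE_space by eventually_elim (auto simp: space_cyl)
      then have "(LINT z:(fst -` {..s} \<inter> space cyl)|cyl. g z) =
          (LINT z:{z \<in> space cyl. 0 < fst z \<and> fst z < s}|cyl. g z)"
        by (intro set_integral_cong_set) (simp_all add: set_borel_measurable_def)
      then show ?thesis using arc[OF 2] by simp
    next
      case 3
      then have "fst -` {..s} \<inter> space cyl = space cyl" by (auto simp: space_cyl)
      then show ?thesis using set_integral_space[OF g] tot by simp
    qed
  qed
  show ?thesis
  proof (rule set_integral_eq_0_sigma_sets[OF g measurable_fst_cyl _ _ _ _ tot A])
    show "sets borel = sigma_sets (space borel) (range (\<lambda>s::real. {..s}))"
      unfolding borel_eq_atMost by simp
    show "Int_stable (range (\<lambda>s::real. {..s}))"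
      by (auto simp: Int_stable_def)
  qed (use half_line in auto)
qed

text \<open>First y: the exponential series turns orthogonality to polynomials into vanishing
  characteristic functions in y of \<open>u z * G z\<close> times each Fourier mode, so all these
  integrate to zero over strips. Then x: for a fixed strip this says that all Fourier coefficients
  vanish, which gives rectangles, and these generate the measurable sets.\<close>

lemma AE_eq_0_if_orthogonal_to_waves:
  assumes u: "sq_integrable u"
    and orth: "\<And>n r. (LINT z|cyl. u z * cnj (wave_fun b n r z)) = 0"
  shows "AE z in cyl. u z = 0"
proof -
  have [measurable]: "u \<in> borel_measurable cyl" using u by (simp add: sq_integrable_def)
  define G where "G z = complex_of_real (exp (- (snd z)\<^sup>2 / 2))" for z :: "real \<times> real"
  have [measurable]: "G \<in> borel_measurable cyl" unfolding G_def by measurable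
  have dom: "integrable cyl (\<lambda>z. u z * of_real (exp (c * \<bar>snd z\<bar> - (snd z)\<^sup>2 / 2)))" for c
    by (rule integrable_mult_sq_integrable[OF u sq_integrable_exp_abs_gauss])
  have uG: "integrable cyl (\<lambda>z. u z * G z)"
    using dom[of 0] by (simp add: G_def)
  have y_char: "(CLINT z|cyl. (u z * G z * exp (\<i> * of_int n * of_real (fst z))) * iexp (t * snd z)) = 0" for n t
  proof -
    \<comment> \<open>The shift of the frequency compensates the phase exp(i n b y) built into
      \<open>wave_fun\<close>.\<close>
    define c where "c = t - b * of_int n"
    let ?e = "\<lambda>z. exp (\<i> * of_int n * of_real (fst z + b * snd z))"
    let ?S = "\<lambda>N z. \<Sum>m<N. (\<i> * of_real (c * snd z)) ^ m /\<^sub>R fact m"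
    have "(\<lambda>N. LINT z|cyl. u z * G z * ?e z * ?S N z) \<longlonglongrightarrow> (CLINT z|cyl. u z * G z * ?e z * iexp (c * snd z))"
    proof (rule integral_dominated_convergence)
      show "integrable cyl (\<lambda>z. norm (u z * of_real (exp (\<bar>c\<bar> * \<bar>snd z\<bar> - (snd z)\<^sup>2 / 2))))"
        by (intro integrable_norm dom)
      show "AE z in cyl. (\<lambda>N. u z * G z * ?e z * ?S N z) \<longlonglongrightarrow> u z * G z * ?e z * iexp (c * snd z)"
        using exp_converges by (intro AE_I2 tendsto_mult_left) (simp add: sums_def)
      show "AE z in cyl. norm (u z * G z * ?e z * ?S N z) \<le>
          norm (u z * of_real (exp (\<bar>c\<bar> * \<bar>snd z\<bar> - (snd z)\<^sup>2 / 2)))" for N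
      proof (rule AE_I2)
        fix z :: "real \<times> real"
        have "norm (?S N z) \<le> (\<Sum>m<N. (\<bar>c\<bar> * \<bar>snd z\<bar>) ^ m /\<^sub>R fact m)"
          by (rule sum_norm_le) (auto simp: norm_mult norm_power abs_mult)
        also have "\<dots> \<le> exp (\<bar>c\<bar> * \<bar>snd z\<bar>)"
          unfolding exp_def by (rule sum_le_suminf[OF summable_exp_generic]) auto
        finally have "norm (?S N z) \<le> exp (\<bar>c\<bar> * \<bar>snd z\<bar>)" .
        then have "cmod (u z) * (exp (- (snd z)\<^sup>2 / 2) * norm (?S N z)) \<le>
            cmod (u z) * (exp (- (snd z)\<^sup>2 / 2) * exp (\<bar>c\<bar> * \<bar>snd z\<bar>))"
          by (intro mult_left_mono) auto
        then show "norm (u z * G z * ?e z * ?S N z) \<le>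
            norm (u z * of_real (exp (\<bar>c\<bar> * \<bar>snd z\<bar> - (snd z)\<^sup>2 / 2)))"
          by (simp add: norm_mult G_def exp_add[symmetric] mult.assoc)
      qed
    qed simp_all
    moreover have "(LINT z|cyl. u z * G z * ?e z * ?S N z) = 0" for N
    proof -
      \<comment> \<open>Orthogonality involves the conjugate of a wave, hence the conjugated
        coefficients here and the mode \<open>- n\<close> below.\<close>
      let ?r = "\<Sum>m<N. monom (cnj ((\<i> * of_real c) ^ m /\<^sub>R fact m)) m"
      have "u z * G z * ?e z * ?S N z = u z * cnj (wave_fun b (- n) ?r z)" for z
      proof -
        have "cnj (poly ?r (of_real (snd z))) = ?S N z"
          by (simp add: poly_sum poly_monom power_mult_distrib scaleR_conv_of_real mult_ac)
        moreover have "cnj (exp (\<i> * of_int (- n) * of_real (fst z + b * snd z))) = ?e z"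
          unfolding exp_cnj by simp
        ultimately show ?thesis
          unfolding wave_fun_def complex_cnj_mult by (simp only: G_def complex_cnj_complex_of_real mult_ac)
      qed
      then show ?thesis by (simp only: orth)
    qed
    ultimately have "(CLINT z|cyl. u z * G z * ?e z * iexp (c * snd z)) = 0"
      by (simp add: LIMSEQ_const_iff)
    moreover have eq: "u z * G z * ?e z * iexp (c * snd z) =
        (u z * G z * exp (\<i> * of_int n * of_real (fst z))) * iexp (t * snd z)" for z
      unfolding mult.assoc exp_add[symmetric] by (simp add: c_def algebra_simps)
    ultimately show ?thesis by (simp only: eq)
  qed
  have int_mode: "integrable cyl (\<lambda>z. u z * G z * exp (\<i> * of_int n * of_real (fst z)))" for n :: int
    by (rule Bochner_Integration.integrable_bound[OF uG]) (auto simp: norm_mult)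
  have strip: "(LINT z:(snd -` B \<inter> space cyl)|cyl. u z * G z * exp (\<i> * of_int n * of_real (fst z))) = 0"
    if "B \<in> sets borel" for B n
    by (rule set_integral_eq_0_if_char_eq_0[OF int_mode measurable_snd_cyl y_char that])
  have rect: "(LINT z:(A \<times> B \<inter> space cyl)|cyl. u z * G z) = 0"
    if A: "A \<in> sets borel" and [measurable]: "B \<in> sets borel" for A B
  proof -
    let ?B = "snd -` B \<inter> space cyl"
    have B: "?B \<in> sets cyl" by measurable
    have "(LINT z:(fst -` A \<inter> space cyl)|cyl. indicator ?B z *\<^sub>R (u z * G z)) = 0"
    proof (rule set_integral_eq_0_if_Fourier_eq_0[OF _ _ A])
      show "complex_integrable cyl (\<lambda>z. indicator ?B z *\<^sub>R (u z * G z))"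
        using B uG by (rule integrable_mult_indicator)
      show "(LINT z|cyl. indicator ?B z *\<^sub>R (u z * G z) * exp (\<i> * of_int n * of_real (fst z))) = 0" for n
        using strip[OF that(2), of n] by (simp add: set_lebesgue_integral_def)
    qed
    moreover have "indicator (fst -` A \<inter> space cyl) z *\<^sub>R (indicator ?B z *\<^sub>R (u z * G z)) =
        indicator (A \<times> B \<inter> space cyl) z *\<^sub>R (u z * G z)" for z
      by (cases z) (auto split: split_indicator)
    ultimately show ?thesis by (simp only: set_lebesgue_integral_def)
  qed
  have tot: "(LINT z|cyl. u z * G z) = 0"
    using rect[of UNIV UNIV] set_integral_space[OF uG] by simp
  let ?E = "{A \<times> B | A B. A \<in> sets (restrict_space lborel {0..2 * pi}) \<and> B \<in> sets (lborel :: real measure)}"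
  have "(LINT z:S|cyl. u z * G z) = 0" if S: "S \<in> sets cyl" for S
  proof -
    have "(LINT z:((\<lambda>z. z) -` S \<inter> space cyl)|cyl. u z * G z) = 0"
    proof (rule set_integral_eq_0_sigma_sets[OF uG measurable_ident_sets[OF refl] _ _ _ _ tot S])
      show "sets cyl = sigma_sets (space cyl) ?E"
        unfolding cyl_def sets_pair_measure space_pair_measure ..
      show "Int_stable ?E" by (rule Int_stable_pair_measure_generator)
      show "?E \<subseteq> Pow (space cyl)"
        unfolding cyl_def space_pair_measure by (rule pair_measure_closed)
      fix R assume "R \<in> ?E"
      then obtain A B where R: "R = A \<times> B" "A \<in> sets (restrict_space lborel {0..2 * pi})" "B \<in> sets borel"
        by auto
      then have "A \<in> sets borel"
        by (auto simp: sets_restrict_space_iff)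
      then show "(LINT z:((\<lambda>z. z) -` R \<inter> space cyl)|cyl. u z * G z) = 0"
        using rect R by simp
    qed
    moreover have "(\<lambda>z. z) -` S \<inter> space cyl = S" using sets.sets_into_space[OF S] by auto
    ultimately show ?thesis by simp
  qed
  from AE_eq_0_if_set_integral_eq_0[OF uG this] show ?thesis
    by (simp add: G_def)
qed

section \<open>Complete inner product spaces and closed relations\<close>

lemma L2_exists_rep: "\<exists>f. sq_integrable f \<and> u = abs_L2 f"
proof -
  have "L2_rel (rep_L2 u) (rep_L2 u)" by (rule Quotient_rep_reflp[OF Quotient_L2])
  moreover have "u = abs_L2 (rep_L2 u)" by (simp add: Quotient_abs_rep[OF Quotient_L2])
  ultimately show ?thesis by (auto simp: L2_rel_def)
qed

lemma L2_rel_refl: "sq_integrable f \<Longrightarrow> L2_rel f f"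
  by (simp add: L2_rel_def)

lemma norm_abs_L2_diff:
  assumes "sq_integrable f" "sq_integrable g"
  shows "(norm (abs_L2 f - abs_L2 g))\<^sup>2 = (LINT z|cyl. (cmod (f z - g z))\<^sup>2)"
  using assms by (simp add: minus_L2.abs_eq norm_L2.abs_eq L2_rel_refl sq_integrable_diff)

lemma nn_integral_abs_L2_diff:
  assumes "sq_integrable f" "sq_integrable g"
  shows "(\<integral>\<^sup>+z. ennreal ((cmod (f z - g z))\<^sup>2) \<partial>cyl) = ennreal ((norm (abs_L2 f - abs_L2 g))\<^sup>2)"
  unfolding norm_abs_L2_diff[OF assms]
  using sq_integrable_diff[OF assms] by (intro nn_integral_eq_integral) (auto simp: sq_integrable_def)

lemma fast_Cauchy_subseq:
  fixes X :: "nat \<Rightarrow> 'a::metric_space"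
  assumes "Cauchy X" and e: "\<And>k. 0 < e k"
  obtains r :: "nat \<Rightarrow> nat" where "strict_mono r" "\<And>j k. k \<le> j \<Longrightarrow> dist (X (r j)) (X (r k)) < e k"
proof -
  have "\<forall>k. \<exists>N. \<forall>m\<ge>N. \<forall>n\<ge>N. dist (X m) (X n) < e k"
    using assms by (auto simp: Cauchy_def)
  then obtain N where N: "\<And>k m n. m \<ge> N k \<Longrightarrow> n \<ge> N k \<Longrightarrow> dist (X m) (X n) < e k" by metis
  \<comment> \<open>Summing the thresholds ensures that \<open>r k\<close> is at least
    \<open>N k\<close>; the added \<open>k\<close> makes \<open>r\<close> strictly
    increasing.\<close>
  define r where "r k = (\<Sum>i\<le>k. N i) + k" for k
  have mono: "strict_mono r"
    by (rule strict_mono_Suc_iff[THEN iffD2]) (simp add: r_def)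
  have "N k \<le> r k" for k
    using member_le_sum[of k "{..k}" N] by (simp add: r_def)
  then have "dist (X (r j)) (X (r k)) < e k" if "k \<le> j" for j k
    using N[of k "r j" "r k"] strict_mono_leD[OF mono that] order_trans by blast
  with mono show ?thesis by (rule that)
qed

text \<open>The almost everywhere limit along a rapidly converging subsequence is the candidate.
  Fatou's lemma carries the distance bounds over to it, and a Cauchy sequence follows its convergent
  subsequences.\<close>

instance L2 :: complete_space
proof
  fix X :: "nat \<Rightarrow> L2"
  assume X: "Cauchy X"
  \<comment> \<open>Squared, the rate 1/4 becomes 1/16, which still leaves a convergent geometric
    series after multiplication by \<open>4 ^ k\<close>.\<close>
  obtain r where r: "strict_mono r" "\<And>j k. k \<le> j \<Longrightarrow> dist (X (r j)) (X (r k)) < (1 / 4) ^ k"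
    using fast_Cauchy_subseq[OF X, of "\<lambda>k. (1 / 4) ^ k"] by auto
  have "\<forall>k. \<exists>f. sq_integrable f \<and> X (r k) = abs_L2 f"
    using L2_exists_rep by blast
  then obtain f where f: "\<And>k. sq_integrable (f k)" "\<And>k. X (r k) = abs_L2 (f k)" by metis
  have [measurable]: "f k \<in> borel_measurable cyl" for k
    using f(1)[of k] by (simp add: sq_integrable_def)
  have dist_f: "(\<integral>\<^sup>+z. ennreal ((cmod (f j z - f k z))\<^sup>2) \<partial>cyl) \<le> ennreal ((1 / 16) ^ k)" if "k \<le> j" for j k
  proof -
    have "(norm (abs_L2 (f j) - abs_L2 (f k)))\<^sup>2 \<le> ((1 / 4) ^ k)\<^sup>2"
      using r(2)[OF that] by (intro power_mono) (auto simp: dist_norm f(2))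
    also have "((1 / 4) ^ k)\<^sup>2 = (1 / 16 :: real) ^ k"
      by (simp add: power2_eq_square flip: power_mult_distrib)
    finally show ?thesis
      unfolding nn_integral_abs_L2_diff[OF f(1) f(1)] by (rule ennreal_leI)
  qed
  define d where "d k z = f (Suc k) z - f k z" for k z
  \<comment> \<open>The factors $4^k$ turn almost everywhere finiteness of the sum into a geometric bound on the increments.\<close>
  have "(\<integral>\<^sup>+z. (\<Sum>k. ennreal (4 ^ k * (cmod (d k z))\<^sup>2)) \<partial>cyl) =
      (\<Sum>k. \<integral>\<^sup>+z. ennreal (4 ^ k * (cmod (d k z))\<^sup>2) \<partial>cyl)"
    by (rule nn_integral_suminf) (simp add: d_def)
  also have "\<dots> \<le> (\<Sum>k. ennreal ((1 / 4) ^ k))"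
  proof (rule suminf_le[OF _ summableI summableI])
    fix k
    have "(\<integral>\<^sup>+z. ennreal (4 ^ k * (cmod (d k z))\<^sup>2) \<partial>cyl) =
        ennreal (4 ^ k) * (\<integral>\<^sup>+z. ennreal ((cmod (f (Suc k) z - f k z))\<^sup>2) \<partial>cyl)"
      by (simp add: ennreal_mult d_def nn_integral_cmult)
    also have "\<dots> \<le> ennreal (4 ^ k) * ennreal ((1 / 16) ^ k)"
      by (intro mult_left_mono dist_f) auto
    also have "\<dots> = ennreal ((1 / 4) ^ k)"
      by (simp flip: ennreal_mult power_mult_distrib)
    finally show "(\<integral>\<^sup>+z. ennreal (4 ^ k * (cmod (d k z))\<^sup>2) \<partial>cyl) \<le> ennreal ((1 / 4) ^ k)" .
  qed
  also have "\<dots> < \<infinity>"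
    by (subst suminf_ennreal2) (auto intro!: summable_geometric)
  finally have "(\<integral>\<^sup>+z. (\<Sum>k. ennreal (4 ^ k * (cmod (d k z))\<^sup>2)) \<partial>cyl) \<noteq> \<infinity>" by simp
  then have "AE z in cyl. (\<Sum>k. ennreal (4 ^ k * (cmod (d k z))\<^sup>2)) \<noteq> \<infinity>"
    by (rule nn_integral_PInf_AE[rotated]) (simp add: d_def)
  then have conv: "AE z in cyl. convergent (\<lambda>k. f k z)"
  proof eventually_elim
    fix z assume fin: "(\<Sum>k. ennreal (4 ^ k * (cmod (d k z))\<^sup>2)) \<noteq> \<infinity>"
    define c where "c = enn2real (\<Sum>k. ennreal (4 ^ k * (cmod (d k z))\<^sup>2))"
    have c: "(\<Sum>k. ennreal (4 ^ k * (cmod (d k z))\<^sup>2)) = ennreal c" "0 \<le> c"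
      using fin by (simp_all add: c_def less_top)
    have bound: "norm (d k z) \<le> sqrt c * (1 / 2) ^ k" for k
    proof -
      have "ennreal (4 ^ k * (cmod (d k z))\<^sup>2) \<le> ennreal c"
        using sum_le_suminf[OF summableI, of "{k}" "\<lambda>k. ennreal (4 ^ k * (cmod (d k z))\<^sup>2)"]
        unfolding c(1) by simp
      moreover have "(2 ^ k)\<^sup>2 = (4 :: real) ^ k"
        by (simp add: power2_eq_square flip: power_mult_distrib)
      ultimately have "(2 ^ k * cmod (d k z))\<^sup>2 \<le> c"
        using c(2) by (simp add: power_mult_distrib)
      then have "2 ^ k * cmod (d k z) \<le> sqrt c" by (rule real_le_rsqrt)
      then show ?thesis by (simp add: power_divide field_simps)
    qed
    have "summable (\<lambda>k. sqrt c * (1 / 2) ^ k)"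
      by (intro summable_mult summable_geometric) simp
    then have "summable (\<lambda>k. d k z)"
      using bound by (rule summable_comparison_test'[where N = 0])
    then have "convergent (\<lambda>n. f 0 z + (\<Sum>k<n. d k z))"
      by (intro convergent_add convergent_const) (simp add: summable_iff_convergent)
    moreover have "f 0 z + (\<Sum>k<n. d k z) = f n z" for n
      by (induction n) (simp_all add: d_def algebra_simps)
    ultimately show "convergent (\<lambda>k. f k z)" by simp
  qed
  define g where "g z = lim (\<lambda>k. f k z)" for z
  have [measurable]: "g \<in> borel_measurable cyl"
    unfolding g_def by (rule borel_measurable_lim_metric) simp
  have dist_g: "(\<integral>\<^sup>+z. ennreal ((cmod (g z - f k z))\<^sup>2) \<partial>cyl) \<le> ennreal ((1 / 16) ^ k)" for k
  proof -
    have "AE z in cyl. ennreal ((cmod (g z - f k z))\<^sup>2) = liminf (\<lambda>j. ennreal ((cmod (f j z - f k z))\<^sup>2))"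
      using conv
    proof eventually_elim
      fix z assume "convergent (\<lambda>k. f k z)"
      then have "(\<lambda>j. f j z) \<longlonglongrightarrow> g z" by (simp add: g_def convergent_LIMSEQ_iff)
      then have "(\<lambda>j. ennreal ((cmod (f j z - f k z))\<^sup>2)) \<longlonglongrightarrow> ennreal ((cmod (g z - f k z))\<^sup>2)"
        by (intro tendsto_intros)
      then show "ennreal ((cmod (g z - f k z))\<^sup>2) = liminf (\<lambda>j. ennreal ((cmod (f j z - f k z))\<^sup>2))"
        by (intro lim_imp_Liminf[symmetric]) auto
    qed
    then have "(\<integral>\<^sup>+z. ennreal ((cmod (g z - f k z))\<^sup>2) \<partial>cyl) =
        (\<integral>\<^sup>+z. liminf (\<lambda>j. ennreal ((cmod (f j z - f k z))\<^sup>2)) \<partial>cyl)"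
      by (rule nn_integral_cong_AE)
    also have "\<dots> \<le> liminf (\<lambda>j. \<integral>\<^sup>+z. ennreal ((cmod (f j z - f k z))\<^sup>2) \<partial>cyl)"
      by (rule nn_integral_liminf) simp
    also have "\<dots> \<le> limsup (\<lambda>j. \<integral>\<^sup>+z. ennreal ((cmod (f j z - f k z))\<^sup>2) \<partial>cyl)"
      by (rule Liminf_le_Limsup) simp
    also have "\<dots> \<le> ennreal ((1 / 16) ^ k)"
      by (rule Limsup_bounded) (use dist_f in \<open>auto simp: eventually_sequentially\<close>)
    finally show ?thesis .
  qed
  have "sq_integrable (\<lambda>z. g z - f 0 z)"
    unfolding sq_integrable_def
    using dist_g[of 0] by (auto intro!: integrableI_bounded simp: le_less_trans)
  from sq_integrable_add[OF this f(1)[of 0]] have g: "sq_integrable g" by simp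
  have "norm (X (r k) - abs_L2 g) \<le> (1 / 4) ^ k" for k
  proof -
    have "(norm (abs_L2 g - abs_L2 (f k)))\<^sup>2 \<le> ((1 / 4) ^ k)\<^sup>2"
      using dist_g[of k] unfolding nn_integral_abs_L2_diff[OF g f(1)]
      by (simp add: power2_eq_square flip: power_mult_distrib)
    then show ?thesis
      unfolding f(2) norm_minus_commute[of "abs_L2 (f k)"] by (rule power2_le_imp_le) simp
  qed
  then have "(\<lambda>k. norm ((X \<circ> r) k - abs_L2 g)) \<longlonglongrightarrow> 0"
    by (intro tendsto_sandwich[OF _ _ tendsto_const LIMSEQ_power_zero[of "1 / 4 :: real"]]) auto
  then have "(X \<circ> r) \<longlonglongrightarrow> abs_L2 g"
    by (simp only: tendsto_norm_zero_iff LIM_zero_iff)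
  then have "X \<longlonglongrightarrow> abs_L2 g"
    by (rule Cauchy_converges_subseq[OF X r(1)])
  then show "convergent X" by (rule convergentI)
qed

text \<open>The projection theorem: \<open>u\<close> is the difference between \<open>x\<close> and
  its nearest point in \<open>S\<close>. Midpoints stay in \<open>S\<close>, so a minimizing
  sequence is Cauchy by the parallelogram identity.\<close>

lemma exists_orthogonal_vector:
  fixes S :: "'a::{real_inner, complete_space} set"
  assumes S: "subspace S" "closed S" and x: "x \<notin> S"
  obtains u where "u \<noteq> 0" "\<And>s. s \<in> S \<Longrightarrow> u \<bullet> s = 0"
proof -
  define D where "D = (INF v\<in>S. (norm (x - v))\<^sup>2)"
  have ne: "S \<noteq> {}" using subspace_0[OF S(1)] by auto
  have bdd: "bdd_below ((\<lambda>v. (norm (x - v))\<^sup>2) ` S)" by (rule bdd_belowI[of _ 0]) auto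
  have D_le: "D \<le> (norm (x - v))\<^sup>2" if "v \<in> S" for v
    unfolding D_def by (rule cINF_lower[OF bdd that])
  have "\<exists>v\<in>S. (norm (x - v))\<^sup>2 < D + inverse (real (Suc n))" for n
    using cINF_less_iff[OF ne bdd, of "D + inverse (real (Suc n))"] by (simp add: D_def)
  then obtain v where v: "\<And>n. v n \<in> S" "\<And>n. (norm (x - v n))\<^sup>2 < D + inverse (real (Suc n))" by metis
  have close: "(norm (v m - v n))\<^sup>2 \<le> 2 * inverse (real (Suc m)) + 2 * inverse (real (Suc n))" for m n
  proof -
    have "(1 / 2) *\<^sub>R (v m + v n) \<in> S" using v S by (simp add: subspace_add subspace_scale)
    then have "4 * D \<le> 4 * (norm (x - (1 / 2) *\<^sub>R (v m + v n)))\<^sup>2" using D_le by simp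
    moreover have "(norm (v m - v n))\<^sup>2 + 4 * (norm (x - (1 / 2) *\<^sub>R (v m + v n)))\<^sup>2 =
        2 * (norm (x - v m))\<^sup>2 + 2 * (norm (x - v n))\<^sup>2"
      by (simp add: power2_norm_eq_inner inner_diff_left inner_diff_right inner_add_left inner_add_right
          inner_commute algebra_simps)
    ultimately show ?thesis using v(2)[of m] v(2)[of n] by linarith
  qed
  have "Cauchy v"
  proof (rule metric_CauchyI)
    fix e :: real assume "0 < e"
    then obtain N where N: "inverse (real (Suc N)) < e\<^sup>2 / 4"
      using reals_Archimedean[of "e\<^sup>2 / 4"] by auto
    have "dist (v m) (v n) < e" if "m \<ge> N" "n \<ge> N" for m n
    proof -
      have "inverse (real (Suc m)) \<le> inverse (real (Suc N))" "inverse (real (Suc n)) \<le> inverse (real (Suc N))"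
        using that by (auto intro: le_imp_inverse_le)
      then have "(norm (v m - v n))\<^sup>2 < e\<^sup>2" using close[of m n] N by linarith
      then show ?thesis unfolding dist_norm by (rule power2_less_imp_less) (use \<open>0 < e\<close> in simp)
    qed
    then show "\<exists>M. \<forall>m\<ge>M. \<forall>n\<ge>M. dist (v m) (v n) < e" by blast
  qed
  then obtain w where w: "v \<longlonglongrightarrow> w" by (auto simp: Cauchy_convergent_iff convergent_def)
  have wS: "w \<in> S" using closed_sequentially[OF S(2)] v(1) w by blast
  have "(norm (x - w))\<^sup>2 \<le> D + 0"
  proof (rule LIMSEQ_le)
    show "(\<lambda>n. (norm (x - v n))\<^sup>2) \<longlonglongrightarrow> (norm (x - w))\<^sup>2" by (intro tendsto_intros w)
    show "(\<lambda>n. D + inverse (real (Suc n))) \<longlonglongrightarrow> D + 0"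
      by (intro tendsto_intros LIMSEQ_inverse_real_of_nat)
  qed (use v(2) less_imp_le in blast)
  then have min: "(norm (x - w))\<^sup>2 \<le> (norm (x - s))\<^sup>2" if "s \<in> S" for s
    using D_le[OF that] by linarith
  show ?thesis
  proof (rule that)
    show "x - w \<noteq> 0" using x wS by auto
    fix s assume s: "s \<in> S"
    show "(x - w) \<bullet> s = 0"
    proof (cases "s = 0")
      case False
      \<comment> \<open>The minimizer of the norm of (x - w) - a s over real a. Inserting it would
        lower the squared distance by a quotient that minimality forces to be zero.\<close>
      define a where "a = (x - w) \<bullet> s / (s \<bullet> s)"
      have "w + a *\<^sub>R s \<in> S" using S wS s by (simp add: subspace_add subspace_scale)
      from min[OF this] have "(norm (x - w))\<^sup>2 \<le> (norm ((x - w) - a *\<^sub>R s))\<^sup>2"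
        by (simp only: diff_diff_eq)
      also have "\<dots> = (norm (x - w))\<^sup>2 - 2 * a * ((x - w) \<bullet> s) + a * a * (s \<bullet> s)"
      proof -
        have "(norm (y - a *\<^sub>R s))\<^sup>2 = (norm y)\<^sup>2 - 2 * a * (y \<bullet> s) + a * a * (s \<bullet> s)" for y
          unfolding power2_norm_eq_inner
          by (simp add: inner_diff_left inner_diff_right inner_commute[of s y] right_diff_distrib)
        then show ?thesis .
      qed
      also have "\<dots> = (norm (x - w))\<^sup>2 - ((x - w) \<bullet> s)\<^sup>2 / (s \<bullet> s)"
      proof -
        have "s \<bullet> s \<noteq> 0" using False by simp
        then show ?thesis unfolding a_def by (simp add: power2_eq_square)
      qed
      finally have "((x - w) \<bullet> s)\<^sup>2 / (s \<bullet> s) \<le> 0" by simp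
      then show ?thesis using False by (auto simp: divide_le_0_iff dest: antisym[OF _ inner_ge_zero])
    qed simp
  qed
qed

section \<open>Closures of linear relations\<close>

lemma subspace_closure:
  fixes S :: "'a::real_normed_vector set"
  assumes "subspace S"
  shows "subspace (closure S)"
proof (rule subspaceI)
  show "0 \<in> closure S" using subspace_0[OF assms] closure_subset by blast
next
  fix x y assume "x \<in> closure S" "y \<in> closure S"
  then obtain a b where ab: "\<And>n::nat. a n \<in> S" "a \<longlonglongrightarrow> x" "\<And>n::nat. b n \<in> S" "b \<longlonglongrightarrow> y"
    unfolding closure_sequential by blast
  then have "(\<lambda>n. a n + b n) \<longlonglongrightarrow> x + y" "\<And>n. a n + b n \<in> S"
    by (auto intro: tendsto_add subspace_add[OF assms])
  then show "x + y \<in> closure S"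
    unfolding closure_sequential by (intro exI[of _ "\<lambda>n. a n + b n"]) simp
next
  fix c x assume "x \<in> closure S"
  then obtain a where "\<And>n::nat. a n \<in> S" "a \<longlonglongrightarrow> x"
    unfolding closure_sequential by blast
  then have "(\<lambda>n. c *\<^sub>R a n) \<longlonglongrightarrow> c *\<^sub>R x" "\<And>n. c *\<^sub>R a n \<in> S"
    by (auto intro: tendsto_scaleR subspace_scale[OF assms])
  then show "c *\<^sub>R x \<in> closure S"
    unfolding closure_sequential by (intro exI[of _ "\<lambda>n. c *\<^sub>R a n"]) simp
qed

text \<open>Extension by continuity, phrased for graphs: the norm bound survives in the closure and
  makes it single-valued, and completeness of the target gives every vector an image.\<close>

lemma closure_bounded_relation:
  fixes G :: "('a::real_normed_vector \<times> 'b::{real_normed_vector, complete_space}) set"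
  assumes sub: "subspace G" and bound: "\<And>u v. (u, v) \<in> G \<Longrightarrow> norm v \<le> norm u"
    and dense: "closure (fst ` G) = UNIV"
  obtains T where "bounded_linear T" "closure G = {(u, T u) | u. True}"
proof -
  have subC: "subspace (closure G)" by (rule subspace_closure[OF sub])
  have "closed {z :: 'a \<times> 'b. norm (snd z) \<le> norm (fst z)}"
    by (intro closed_Collect_le continuous_intros)
  then have "closure G \<subseteq> {z. norm (snd z) \<le> norm (fst z)}"
    by (intro closure_minimal) (auto simp: bound)
  then have boundC: "norm v \<le> norm u" if "(u, v) \<in> closure G" for u v using that by auto
  have uniq: "v = v'" if "(u, v) \<in> closure G" "(u, v') \<in> closure G" for u v v'
    using boundC[of 0 "v - v'"] subspace_diff[OF subC that] by simp
  have ex: "\<exists>v. (u, v) \<in> closure G" for u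
  proof -
    have "u \<in> closure (fst ` G)" using dense by simp
    then obtain a where a: "\<And>n::nat. a n \<in> fst ` G" "a \<longlonglongrightarrow> u" unfolding closure_sequential by blast
    then have "\<forall>n. \<exists>c. (a n, c) \<in> G" by force
    then obtain c where c: "\<And>n. (a n, c n) \<in> G" by metis
    have "dist (c m) (c n) \<le> dist (a m) (a n)" for m n
      using bound[of "a m - a n" "c m - c n"] subspace_diff[OF sub c c, of m n] by (simp add: dist_norm)
    then have "Cauchy c"
      using LIMSEQ_imp_Cauchy[OF a(2)] unfolding Cauchy_def by (meson le_less_trans)
    then obtain v where "c \<longlonglongrightarrow> v" by (auto simp: Cauchy_convergent_iff convergent_def)
    then have "(\<lambda>n. (a n, c n)) \<longlonglongrightarrow> (u, v)" using a(2) by (intro tendsto_Pair)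
    then have "(u, v) \<in> closure G" unfolding closure_sequential using c by (intro exI[of _ "\<lambda>n. (a n, c n)"]) simp
    then show ?thesis ..
  qed
  then obtain T where T: "\<And>u. (u, T u) \<in> closure G" by metis
  have "bounded_linear T"
  proof (rule bounded_linear_intro[where K = 1])
    show "T (u + v) = T u + T v" for u v
      using uniq[OF T] subspace_add[OF subC T[of u] T[of v]] by simp
    show "T (c *\<^sub>R u) = c *\<^sub>R T u" for c u
      using uniq[OF T] subspace_scale[OF subC T[of u], of c] by simp
    show "norm (T u) \<le> norm u * 1" for u
      using boundC[OF T] by simp
  qed
  moreover have "closure G = {(u, T u) | u. True}"
    using T uniq by fastforce
  ultimately show ?thesis by (rule that)
qed

section \<open>The graph of $e^{-tL_b}$\<close>

text \<open>The elements of \<open>span_graph\<close> in Fock coordinates, with one arbitrary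
  polynomial per mode in place of the coefficients of eigenfunctions.\<close>

definition wave_sum_pair :: "real \<Rightarrow> complex \<Rightarrow> int set \<Rightarrow> (int \<Rightarrow> complex poly) \<Rightarrow> L2 \<times> L2"
  where "wave_sum_pair b t J p =
    (\<Sum>n\<in>J. wave b n (hermite_sum (p n)),
     \<Sum>n\<in>J. wave b n (hermite_sum (smult (exp (- t * of_real ((b * of_int n)\<^sup>2 / 2)))
       (pcompose (p n) [:2 * \<i> * of_real (b * of_int n) * (1 - exp (- t)), exp (- t):]))))"

lemma eig_sum_pair_eq:
  assumes "finite J" "\<And>n. n \<in> J \<Longrightarrow> finite (K n)"
  shows "(\<Sum>(n, k)\<in>(SIGMA n:J. K n). \<alpha> n k *\<^sub>C eig b n k,
      \<Sum>(n, k)\<in>(SIGMA n:J. K n). (exp (- t * of_real (eigval b n k)) * \<alpha> n k) *\<^sub>C eig b n k) =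
    wave_sum_pair b t J (\<lambda>n. \<Sum>k\<in>K n. smult (\<alpha> n k * eig_const b n k)
      ([:2 * (- \<i> * of_real (b * of_int n)), 1:] ^ k))"
proof -
  let ?L = "\<lambda>n. [:2 * (- \<i> * of_real (b * of_int n)), 1:]"
  let ?M = "\<lambda>n. [:2 * \<i> * of_real (b * of_int n) * (1 - exp (- t)), exp (- t):]"
  let ?e = "\<lambda>n. exp (- t * of_real ((b * of_int n)\<^sup>2 / 2))"
  have 1: "c *\<^sub>C eig b n k = wave b n (hermite_sum (smult (c * eig_const b n k) (?L n ^ k)))" for c n k
    by (simp add: eig_eq_wave scaleC_scaleC hermite_sum_smult wave_smult)
  \<comment> \<open>The root 2 i b n of \<open>?L n\<close> is the fixed point of the substitution
    \<open>?M n\<close>.\<close>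
  have pow: "pcompose (?L n ^ k) (?M n) = smult (exp (- t) ^ k) (?L n ^ k)" for n k
  proof -
    have "pcompose (?L n) (?M n) = smult (exp (- t)) (?L n)"
      by (simp add: pcompose_pCons algebra_simps)
    moreover have "pcompose (q ^ k) r = pcompose q r ^ k" for q r :: "complex poly"
      by (induction k) (simp_all add: pcompose_1 pcompose_mult)
    ultimately show ?thesis by (simp only: smult_power)
  qed
  have exp_eigval: "exp (- t * of_real (eigval b n k)) = ?e n * exp (- t) ^ k" for n k
  proof -
    have "- t * of_real (eigval b n k) = - t * of_real ((b * of_int n)\<^sup>2 / 2) + of_nat k * (- t)"
      by (simp add: eigval_def algebra_simps)
    then show ?thesis by (simp only: exp_add exp_of_nat_mult)
  qed
  have 2: "(exp (- t * of_real (eigval b n k)) * c) *\<^sub>C eig b n k =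
      wave b n (hermite_sum (smult (?e n) (pcompose (smult (c * eig_const b n k) (?L n ^ k)) (?M n))))" for c n k
    unfolding 1 exp_eigval pcompose_smult pow by (simp add: mult_ac)
  have S: "(\<Sum>n\<in>J. \<Sum>k\<in>K n. h n k) = (\<Sum>(n, k)\<in>(SIGMA n:J. K n). h n k)" for h :: "int \<Rightarrow> nat \<Rightarrow> L2"
    using assms by (simp add: sum.Sigma)
  show ?thesis
    unfolding wave_sum_pair_def 2 pcompose_sum smult_sum_right hermite_sum_sum wave_sum S unfolding 1 ..
qed

lemma span_graph_eq_wave_sums:
  "span_graph b t = {wave_sum_pair b t J p | J p. finite J}"
proof (intro equalityI subsetI)
  fix z assume "z \<in> span_graph b t"
  then obtain I \<alpha> where I: "finite I"
    and z: "z = (\<Sum>(n, k)\<in>I. \<alpha> n k *\<^sub>C eig b n k,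
      \<Sum>(n, k)\<in>I. (exp (- t * of_real (eigval b n k)) * \<alpha> n k) *\<^sub>C eig b n k)"
    by (auto simp: span_graph_def)
  have S: "I = (SIGMA n:fst ` I. {k. (n, k) \<in> I})" by force
  have fin: "finite {k. (n, k) \<in> I}" for n
    by (rule finite_subset[of _ "snd ` I"]) (use I in force)+
  show "z \<in> {wave_sum_pair b t J p | J p. finite J}"
    unfolding z by (subst (1 2) S, subst eig_sum_pair_eq) (use I fin in auto)
next
  fix z assume "z \<in> {wave_sum_pair b t J p | J p. finite J}"
  then obtain J p where J: "finite J" and z: "z = wave_sum_pair b t J p" by auto
  let ?L = "\<lambda>n. [:2 * (- \<i> * of_real (b * of_int n)), 1:]"
  \<comment> \<open>The coefficients of \<open>?q n\<close> are the Taylor coefficients of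
    \<open>p n\<close> at 2 i b n, which express any polynomial by the powers belonging to
    eigenfunctions.\<close>
  let ?q = "\<lambda>n. pcompose (p n) [:2 * \<i> * of_real (b * of_int n), 1:]"
  have "p n = pcompose (?q n) (?L n)" for n
    by (simp flip: pcompose_assoc add: pcompose_pCons)
  then have "p n = (\<Sum>k\<le>degree (?q n). smult (coeff (?q n) k) (?L n ^ k))" for n
    using pcompose_eq_sum[OF order_refl, of "?q n" "?L n"] by simp
  then have "p = (\<lambda>n. \<Sum>k\<in>{..degree (?q n)}. smult (coeff (?q n) k / eig_const b n k * eig_const b n k) (?L n ^ k))"
    by (simp add: fun_eq_iff eig_const_nonzero)
  then have "z = wave_sum_pair b t J (\<lambda>n. \<Sum>k\<in>{..degree (?q n)}. smult (coeff (?q n) k / eig_const b n k * eig_const b n k) (?L n ^ k))"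
    unfolding z by (rule arg_cong)
  also have "\<dots> \<in> span_graph b t"
    unfolding eig_sum_pair_eq[OF J finite_atMost, symmetric] span_graph_def mem_Collect_eq
    by (intro exI[of _ "SIGMA n:J. {..degree (?q n)}"] exI[of _ "\<lambda>n k. coeff (?q n) k / eig_const b n k"]
        conjI refl finite_SigmaI J finite_atMost)
  finally show "z \<in> span_graph b t" .
qed

lemma wave_sum_pair_extend:
  assumes "finite J'" "J \<subseteq> J'"
  shows "wave_sum_pair b t J p = wave_sum_pair b t J' (\<lambda>n. if n \<in> J then p n else 0)"
  unfolding wave_sum_pair_def
  using assms by (auto intro!: sum.mono_neutral_cong_left)

lemma wave_sum_pair_add:
  "wave_sum_pair b t J p + wave_sum_pair b t J q = wave_sum_pair b t J (\<lambda>n. p n + q n)"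
  by (simp add: wave_sum_pair_def sum.distrib hermite_sum_add wave_add pcompose_add smult_add_right)

lemma wave_sum_pair_smult:
  "wave_sum_pair b t J (\<lambda>n. smult c (p n)) =
    (c *\<^sub>C fst (wave_sum_pair b t J p), c *\<^sub>C snd (wave_sum_pair b t J p))"
  by (simp add: wave_sum_pair_def scaleC_sum hermite_sum_smult wave_smult pcompose_smult scaleC_scaleC mult.commute)

lemma subspace_span_graph: "subspace (span_graph b t)"
proof (rule subspaceI)
  show "0 \<in> span_graph b t"
    unfolding span_graph_eq_wave_sums
    by (auto intro!: exI[of _ "{}"] simp: wave_sum_pair_def zero_prod_def)
next
  fix y z assume "y \<in> span_graph b t" "z \<in> span_graph b t"
  then obtain J p J' q where "finite J" "y = wave_sum_pair b t J p" "finite J'" "z = wave_sum_pair b t J' q"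
    unfolding span_graph_eq_wave_sums by blast
  then have "finite (J \<union> J')" "y + z = wave_sum_pair b t (J \<union> J') (\<lambda>n. (if n \<in> J then p n else 0) + (if n \<in> J' then q n else 0))"
    using wave_sum_pair_extend[of "J \<union> J'" J] wave_sum_pair_extend[of "J \<union> J'" J']
    by (simp_all add: wave_sum_pair_add)
  then show "y + z \<in> span_graph b t"
    unfolding span_graph_eq_wave_sums by blast
next
  fix c z assume "z \<in> span_graph b t"
  then obtain J p where "finite J" "z = wave_sum_pair b t J p"
    unfolding span_graph_eq_wave_sums by blast
  then have "finite J" "c *\<^sub>R z = wave_sum_pair b t J (\<lambda>n. smult (of_real c) (p n))"
    by (simp_all add: wave_sum_pair_smult scaleR_prod_def scaleR_eq_scaleC)
  then show "c *\<^sub>R z \<in> span_graph b t"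
    unfolding span_graph_eq_wave_sums by blast
qed

text \<open>\<open>closure_bounded_relation\<close> yields a real linear map only; complex
  homogeneity passes from the graph to its closure by continuity.\<close>

lemma scaleC_span_graph:
  assumes "(u, v) \<in> closure (span_graph b t)"
  shows "(c *\<^sub>C u, c *\<^sub>C v) \<in> closure (span_graph b t)"
proof -
  let ?m = "\<lambda>z. (c *\<^sub>C fst z, c *\<^sub>C snd z)"
  have c: "continuous_on A (\<lambda>z. c *\<^sub>C g z)" if "continuous_on A g" for g :: "L2 \<times> L2 \<Rightarrow> L2" and A
    by (rule bounded_linear.continuous_on[OF bounded_linear_scaleC that])
  have "continuous_on (closure (span_graph b t)) ?m"
    by (intro continuous_on_Pair c continuous_on_fst continuous_on_snd continuous_on_id)
  moreover have "?m ` span_graph b t \<subseteq> span_graph b t"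
  proof
    fix z assume "z \<in> ?m ` span_graph b t"
    then obtain J p where "finite J" "z = ?m (wave_sum_pair b t J p)"
      unfolding span_graph_eq_wave_sums by blast
    then show "z \<in> span_graph b t"
      unfolding span_graph_eq_wave_sums wave_sum_pair_smult[symmetric] by blast
  qed
  then have "?m ` span_graph b t \<subseteq> closure (span_graph b t)"
    using closure_subset by blast
  ultimately have "?m ` closure (span_graph b t) \<subseteq> closure (span_graph b t)"
    by (intro image_closure_subset) auto
  then show ?thesis using assms by force
qed

text \<open>A nonzero vector orthogonal to the closure would be orthogonal to every wave, because
  \<open>hermite_sum_surj\<close> realizes every polynomial; this contradicts
  \<open>AE_eq_0_if_orthogonal_to_waves\<close>.\<close>

lemma dense_span_graph: "closure (fst ` span_graph b t) = UNIV"
proof (rule ccontr)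
  assume "closure (fst ` span_graph b t) \<noteq> UNIV"
  then obtain x where x: "x \<notin> closure (fst ` span_graph b t)" by blast
  have "subspace (closure (fst ` span_graph b t))"
    by (intro subspace_closure linear_subspace_image subspace_span_graph linear_fst)
  then obtain u where u: "u \<noteq> 0" "\<And>s. s \<in> closure (fst ` span_graph b t) \<Longrightarrow> u \<bullet> s = 0"
    using exists_orthogonal_vector[OF _ closed_closure x] by blast
  have orth: "u \<bullet> wave b n r = 0" for n r
  proof (rule u(2))
    obtain p where "hermite_sum p = r" using hermite_sum_surj by blast
    then have "wave b n r = fst (wave_sum_pair b t {n} (\<lambda>_. p))"
      by (simp add: wave_sum_pair_def)
    then have "wave b n r \<in> fst ` span_graph b t"
      unfolding span_graph_eq_wave_sums by blast
    then show "wave b n r \<in> closure (fst ` span_graph b t)"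
      by (rule subsetD[OF closure_subset])
  qed
  from L2_exists_rep[of u] obtain f where f: "sq_integrable f" "u = abs_L2 f" by blast
  have inner: "v \<bullet> w = Re (v * cnj w)" for v w :: complex
    by (simp add: inner_complex_def)
  have sq_cnj: "sq_integrable (\<lambda>z. cnj (wave_fun b n r z))" for n r
  proof -
    have "(\<lambda>z. cnj (wave_fun b n r z)) \<in> borel_measurable cyl"
      by (rule measurable_compose[OF borel_measurable_wave_fun])
        (intro borel_measurable_continuous_onI continuous_intros)
    then show ?thesis
      using sq_integrable_wave_fun[of b n r] by (simp add: sq_integrable_def)
  qed
  have int: "integrable cyl (\<lambda>z. f z * cnj (wave_fun b n r z))" for n r
    by (rule integrable_mult_sq_integrable[OF f(1) sq_cnj])
  have Re: "Re (LINT z|cyl. f z * cnj (wave_fun b n r z)) = 0" for n r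
  proof -
    have "u \<bullet> wave b n r = (LINT z|cyl. f z \<bullet> wave_fun b n r z)"
      unfolding f(2) wave_def by (simp add: inner_L2.abs_eq L2_rel_refl f(1) sq_integrable_wave_fun)
    also have "\<dots> = Re (LINT z|cyl. f z * cnj (wave_fun b n r z))"
      unfolding inner by (rule integral_Re[OF int])
    finally show ?thesis using orth by simp
  qed
  have "(LINT z|cyl. f z * cnj (wave_fun b n r z)) = 0" for n r
  proof -
    \<comment> \<open>The inner product of \<open>L2\<close> controls the real part only; testing
      with i r in place of r gives the imaginary part.\<close>
    have "(LINT z|cyl. f z * cnj (wave_fun b n (smult \<i> r) z)) = (LINT z|cyl. - \<i> * (f z * cnj (wave_fun b n r z)))"
      unfolding wave_fun_smult by (simp add: mult_ac)
    also have "\<dots> = - \<i> * (LINT z|cyl. f z * cnj (wave_fun b n r z))"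
      by (rule integral_mult_right_zero)
    finally show ?thesis using Re[of n r] Re[of n "smult \<i> r"] by (simp add: complex_eq_iff)
  qed
  then have "AE z in cyl. f z = 0"
    by (rule AE_eq_0_if_orthogonal_to_waves[OF f(1)])
  then have "L2_rel f (\<lambda>_. 0)"
    using f(1) by (simp add: L2_rel_def sq_integrable_0)
  then have "u = 0"
    unfolding f(2) zero_L2_def by (rule Quotient_rel_abs[OF Quotient_L2])
  with u(1) show False by simp
qed

section \<open>Reduction of boundedness to estimates on single modes\<close>

lemma norm_wave_sum_pair:
  assumes "finite J"
  shows "(norm (fst (wave_sum_pair b t J p)))\<^sup>2 = 2 * pi * sqrt pi * (\<Sum>n\<in>J. fock_norm (p n))"
    and "(norm (snd (wave_sum_pair b t J p)))\<^sup>2 = 2 * pi * sqrt pi *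
      (\<Sum>n\<in>J. exp (- Re t * (b * of_int n)\<^sup>2) * fock_norm (pcompose (p n)
        [:2 * \<i> * of_real (b * of_int n) * (1 - exp (- t)), exp (- t):]))"
proof -
  have "(cmod (exp (- t * of_real ((b * of_int n)\<^sup>2 / 2))))\<^sup>2 = exp (- Re t * (b * of_int n)\<^sup>2)" for n
    by (simp add: norm_exp_eq_Re flip: exp_double)
  then show "(norm (snd (wave_sum_pair b t J p)))\<^sup>2 = 2 * pi * sqrt pi *
      (\<Sum>n\<in>J. exp (- Re t * (b * of_int n)\<^sup>2) * fock_norm (pcompose (p n)
        [:2 * \<i> * of_real (b * of_int n) * (1 - exp (- t)), exp (- t):]))"
    unfolding wave_sum_pair_def snd_conv norm_sum_wave_hermite_sum[OF assms] fock_norm_smult by simp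
qed (simp add: wave_sum_pair_def norm_sum_wave_hermite_sum[OF assms])

lemma is_bounded_operatorI:
  assumes bound: "\<And>n p. exp (- Re t * (b * of_int n)\<^sup>2) * fock_norm (pcompose p
    [:2 * \<i> * of_real (b * of_int n) * (1 - exp (- t)), exp (- t):]) \<le> fock_norm p"
  shows "is_bounded_operator (exp_hypoelliptic b t)"
proof -
  have "norm v \<le> norm u" if "(u, v) \<in> span_graph b t" for u v
  proof -
    obtain J p where J: "finite J" "(u, v) = wave_sum_pair b t J p"
      using \<open>(u, v) \<in> span_graph b t\<close> unfolding span_graph_eq_wave_sums by blast
    then have uv: "u = fst (wave_sum_pair b t J p)" "v = snd (wave_sum_pair b t J p)"
      by (metis fst_conv, metis snd_conv)
    have "(norm v)\<^sup>2 \<le> (norm u)\<^sup>2"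
      unfolding uv norm_wave_sum_pair[OF J(1)] by (intro mult_left_mono sum_mono bound) simp
    then show ?thesis by (rule power2_le_imp_le) simp
  qed
  from closure_bounded_relation[OF subspace_span_graph this dense_span_graph]
  obtain T where T: "bounded_linear T" "closure (span_graph b t) = {(u, T u) | u. True}" by blast
  have "T (c *\<^sub>C u) = c *\<^sub>C T u" for c u
    using scaleC_span_graph[of u "T u" b t c] T(2) by auto
  with T show ?thesis
    unfolding is_bounded_operator_def exp_hypoelliptic_def by blast
qed

text \<open>The operator is tested on one mode at a time with truncated exentials replaced by their
  limit bound from \<open>fock_norm_pcompose_bound_imp\<close>. The bound is uniform in
  \<open>n\<close> and \<open>s\<close>, which can both be chosen freely afterwards.\<close>

lemma is_bounded_operatorD:
  assumes "is_bounded_operator (exp_hypoelliptic b t)"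
  shows "\<exists>M. \<forall>n s. exp (- Re t * (b * of_int n)\<^sup>2 +
      2 * Re (s * (2 * \<i> * of_real (b * of_int n) * (1 - exp (- t)))) +
      2 * (cmod (s * exp (- t)))\<^sup>2 - 2 * (cmod s)\<^sup>2) \<le> M"
proof -
  obtain T where T: "bounded_linear T" "closure (span_graph b t) = {(u, T u) | u. True}"
    using assms unfolding is_bounded_operator_def exp_hypoelliptic_def by blast
  obtain K where K: "\<And>u. norm (T u) \<le> norm u * K"
    using bounded_linear.bounded[OF T(1)] by blast
  have "exp (- Re t * (b * of_int n)\<^sup>2 +
      2 * Re (s * (2 * \<i> * of_real (b * of_int n) * (1 - exp (- t)))) +
      2 * (cmod (s * exp (- t)))\<^sup>2 - 2 * (cmod s)\<^sup>2) \<le> K\<^sup>2" for n s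
  proof -
    let ?g = "2 * \<i> * of_real (b * of_int n) * (1 - exp (- t))"
    let ?E = "exp (- Re t * (b * of_int n)\<^sup>2)"
    have "fock_norm (pcompose p [:?g, exp (- t):]) \<le> (K\<^sup>2 / ?E) * fock_norm p" for p
    proof -
      let ?z = "wave_sum_pair b t {n} (\<lambda>_. p)"
      have "?z \<in> span_graph b t" unfolding span_graph_eq_wave_sums by blast
      then have "?z \<in> {(u, T u) | u. True}" using closure_subset T(2) by blast
      then have "norm (snd ?z) \<le> norm (fst ?z) * K" using K by auto
      then have "(norm (snd ?z))\<^sup>2 \<le> (norm (fst ?z))\<^sup>2 * K\<^sup>2"
        unfolding power_mult_distrib[symmetric] by (intro power_mono) auto
      then have "?E * fock_norm (pcompose p [:?g, exp (- t):]) \<le> fock_norm p * K\<^sup>2"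
        unfolding norm_wave_sum_pair[OF finite.insertI[OF finite.emptyI]] mult.assoc by simp
      then show ?thesis by (simp add: field_simps)
    qed
    then have "exp (2 * Re (s * ?g) + 2 * (cmod (s * exp (- t)))\<^sup>2) \<le> (K\<^sup>2 / ?E) * exp (2 * (cmod s)\<^sup>2)"
      by (rule fock_norm_pcompose_bound_imp) simp
    then have "?E * exp (2 * Re (s * ?g) + 2 * (cmod (s * exp (- t)))\<^sup>2) / exp (2 * (cmod s)\<^sup>2) \<le> K\<^sup>2"
      by (simp add: field_simps)
    then show ?thesis by (simp only: exp_add[symmetric] exp_diff[symmetric] add.assoc add_diff_eq)
  qed
  then show ?thesis by blast
qed

text \<open>Numerator and denominator of the quotient in \<open>R_fun\<close> are multiplied by 2
  exp(- Re t).\<close>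

lemma R_fun_eq:
  assumes "Re t > 0"
  shows "R_fun t = Re t / 2 - (cmod (1 - exp (- t)))\<^sup>2 / (1 - (cmod (exp (- t)))\<^sup>2)"
proof -
  define E where "E = exp (- Re t)"
  have E: "0 < E" "E < 1" "exp (Re t) = 1 / E" using assms by (simp_all add: E_def exp_minus field_simps)
  have E2: "E\<^sup>2 < 1" using E by (simp add: power_less_one_iff)
  have n: "cmod (exp (- t)) = E" by (simp add: E_def norm_exp_eq_Re)
  have "(1 - E * c)\<^sup>2 + (E * s)\<^sup>2 = 1 - 2 * E * c + E\<^sup>2 * (s\<^sup>2 + c\<^sup>2)" for c s :: real
    by (simp add: power2_eq_square algebra_simps)
  moreover have "Re (1 - exp (- t)) = 1 - E * cos (Im t)" "Im (1 - exp (- t)) = E * sin (Im t)"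
    by (simp_all add: Re_exp Im_exp E_def)
  ultimately have "(cmod (1 - exp (- t)))\<^sup>2 = 1 - 2 * E * cos (Im t) + E\<^sup>2"
    unfolding cmod_power2 by (simp only: sin_cos_squared_add mult_1_right)
  moreover have "(cosh (Re t) - cos (Im t)) / sinh (Re t) = (1 - 2 * E * cos (Im t) + E\<^sup>2) / (1 - E\<^sup>2)"
  proof -
    have "cosh (Re t) - cos (Im t) = (1 - 2 * E * cos (Im t) + E\<^sup>2) / (2 * E)"
      using E by (simp add: cosh_def E(3) E_def[symmetric] power2_eq_square field_simps)
    moreover have "sinh (Re t) = (1 - E\<^sup>2) / (2 * E)"
      using E by (simp add: sinh_def E(3) E_def[symmetric] power2_eq_square field_simps)
    ultimately show ?thesis using E by simp
  qed
  ultimately show ?thesis unfolding R_fun_def n by simp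
qed

lemma nonpos_if_exp_multiples_bounded:
  fixes c M :: real
  assumes "\<And>k::nat. exp (real k * c) \<le> M"
  shows "c \<le> 0"
proof (rule ccontr)
  assume "\<not> c \<le> 0"
  then obtain k :: nat where "M < real k * c" using reals_Archimedean3[of c] by auto
  also have "\<dots> < exp (real k * c)" using exp_ge_add_one_self[of "real k * c"] by linarith
  finally show False using assms[of k] by simp
qed

theorem theorem2p1:
  fixes b :: real and t :: complex
  assumes "b \<noteq> 0"
  shows "is_bounded_operator (exp_hypoelliptic b t) \<longleftrightarrow>
    (\<exists>m::int. t = 2 * of_real pi * \<i> * of_int m) \<or> (Re t > 0 \<and> R_fun t \<ge> 0)"
proof -
  define w where "w = exp (- t)"
  define v where "v = (cmod w)\<^sup>2"
  define g where "g n = 2 * \<i> * of_real (b * of_int n) * (1 - w)" for n :: int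
  have g2: "(cmod (g n))\<^sup>2 = 4 * (b * of_int n)\<^sup>2 * (cmod (1 - w))\<^sup>2" for n
    by (simp add: g_def norm_mult power_mult_distrib)
  have v_Re: "v = exp (- 2 * Re t)"
    by (simp add: v_def w_def norm_exp_eq_Re flip: exp_double)
  \<comment> \<open>The logarithm of the squared norm of the n-th mode: the scalar factor of the
    mode together with the constant of \<open>fock_norm_pcompose_le\<close>.\<close>
  have exponent: "- Re t * (b * of_int n)\<^sup>2 + (cmod (g n))\<^sup>2 / (2 * (1 - v)) = (real_of_int n)\<^sup>2 * (- 2 * b\<^sup>2 * R_fun t)"
    if "Re t > 0" for n
  proof -
    have "v < 1" using that by (simp add: v_Re)
    then show ?thesis
      unfolding R_fun_eq[OF that] w_def[symmetric] v_def[symmetric] g2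
      by (simp add: power_mult_distrib field_simps)
  qed
  show ?thesis
  proof
    assume "(\<exists>m::int. t = 2 * of_real pi * \<i> * of_int m) \<or> (Re t > 0 \<and> R_fun t \<ge> 0)"
    then show "is_bounded_operator (exp_hypoelliptic b t)"
    proof
      assume "\<exists>m::int. t = 2 * of_real pi * \<i> * of_int m"
      then obtain m :: int where t: "t = 2 * of_real pi * \<i> * of_int m" by blast
      then have "w = exp (2 * of_int (- m) * of_real pi * \<i>)" by (simp add: w_def mult_ac)
      also have "\<dots> = 1" using exp_integer_2pi[of "of_int (- m)"] by simp
      finally have "exp (- t) = 1" by (simp add: w_def)
      moreover have "Re t = 0" by (simp add: t)
      ultimately show ?thesis by (intro is_bounded_operatorI) simp
    next
      assume R: "Re t > 0 \<and> R_fun t \<ge> 0"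
      then have w1: "cmod w < 1" by (simp add: w_def norm_exp_eq_Re)
      show ?thesis
      proof (rule is_bounded_operatorI)
        fix n p
        have "exp (- Re t * (b * of_int n)\<^sup>2) * fock_norm (pcompose p [:g n, w:]) \<le>
            exp (- Re t * (b * of_int n)\<^sup>2) * (exp ((cmod (g n))\<^sup>2 / (2 * (1 - v))) * fock_norm p)"
          unfolding v_def by (intro mult_left_mono fock_norm_pcompose_le w1) simp
        also have "\<dots> = exp ((real_of_int n)\<^sup>2 * (- 2 * b\<^sup>2 * R_fun t)) * fock_norm p"
          using exponent[of n] R by (simp add: exp_add[symmetric] flip: mult.assoc)
        also have "\<dots> \<le> 1 * fock_norm p"
          using R by (intro mult_right_mono fock_norm_nonneg) simp
        finally show "exp (- Re t * (b * of_int n)\<^sup>2) * fock_norm (pcompose p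
            [:2 * \<i> * of_real (b * of_int n) * (1 - exp (- t)), exp (- t):]) \<le> fock_norm p"
          by (simp add: g_def w_def)
      qed
    qed
  next
    assume "is_bounded_operator (exp_hypoelliptic b t)"
    from is_bounded_operatorD[OF this]
    obtain M where "\<And>n s. exp (- Re t * (b * of_int n)\<^sup>2 + 2 * Re (s * g n) +
        2 * (cmod (s * w))\<^sup>2 - 2 * (cmod s)\<^sup>2) \<le> M"
      unfolding w_def g_def by blast
    moreover have "2 * (cmod (s * w))\<^sup>2 - 2 * (cmod s)\<^sup>2 = - (2 * (1 - v)) * (cmod s)\<^sup>2" for s
      by (simp add: v_def norm_mult power_mult_distrib algebra_simps)
    moreover have "x + y + p - q = x + y - r" if "p - q = - r" for x y p q r :: real
      using that by linarith
    ultimately have M: "exp (- Re t * (b * of_int n)\<^sup>2 + 2 * Re (s * g n) - 2 * (1 - v) * (cmod s)\<^sup>2) \<le> M" for n s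
      by (metis minus_mult_left)
    \<comment> \<open>In the mode \<open>n = 0\<close> the shift vanishes, and
      \<open>s = sqrt k\<close> makes the exponent a multiple of \<open>k\<close>; this excludes |w|
      > 1.\<close>
    have "exp (real k * (- 2 * (1 - v))) \<le> M" for k
      using M[of 0 "of_real (sqrt (real k))"] by (simp add: g_def algebra_simps)
    then have "- 2 * (1 - v) \<le> 0" by (rule nonpos_if_exp_multiples_bounded)
    then have "v \<le> 1" by simp
    then consider "v = 1" | "v < 1" by linarith
    then show "(\<exists>m::int. t = 2 * of_real pi * \<i> * of_int m) \<or> (Re t > 0 \<and> R_fun t \<ge> 0)"
    proof cases
      case 1
      \<comment> \<open>For \<open>v = 1\<close> the term quadratic in \<open>s\<close> disappears,
        so \<open>s = k * cnj (g 1)\<close> gives unbounded linear growth unless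
        \<open>g 1 = 0\<close>.\<close>
      have "exp (real k * (2 * (cmod (g 1))\<^sup>2)) \<le> M" for k
      proof -
        have Re: "Re (of_nat k * cnj (g 1) * g 1) = real k * (cmod (g 1))\<^sup>2"
          unfolding mult.assoc mult.commute[of "cnj (g 1)"] complex_norm_square[symmetric] by simp
        have "Re t = 0" using 1 by (simp add: v_Re)
        then show ?thesis using M[of 1 "of_nat k * cnj (g 1)"] unfolding Re 1 by (simp add: mult_ac)
      qed
      then have "2 * (cmod (g 1))\<^sup>2 \<le> 0" by (rule nonpos_if_exp_multiples_bounded)
      then have "exp (- t) = 1" using assms by (simp add: g_def w_def)
      then obtain m :: int where m: "Re t = 0" "- Im t = of_int (2 * m) * pi"
        by (auto simp: exp_eq_1)
      have "t = 2 * of_real pi * \<i> * of_int (- m)"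
        using m by (simp add: complex_eq_iff mult_ac)
      then show ?thesis by blast
    next
      case 2
      then have t: "Re t > 0" by (simp add: v_Re)
      have bound: "exp ((real_of_int n)\<^sup>2 * (- 2 * b\<^sup>2 * R_fun t)) \<le> M" for n
      proof -
        \<comment> \<open>The choice \<open>s = c * cnj (g n)\<close> maximizes the concave function
          2 Re(s g) - 2 (1 - v) |s|^2; its maximum |g|^2 / (2 (1 - v)) is the exponent of the upper
          bound.\<close>
        define c where "c = 1 / (2 * (1 - v))"
        let ?s = "of_real c * cnj (g n)"
        have "Re (?s * g n) = c * (cmod (g n))\<^sup>2"
          unfolding mult.assoc mult.commute[of "cnj (g n)"] complex_norm_square[symmetric] by simp
        moreover have "2 * (1 - v) * (cmod ?s)\<^sup>2 = c * (cmod (g n))\<^sup>2"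
        proof -
          have c: "2 * (1 - v) * c = 1" using 2 by (simp add: c_def)
          have "(cmod ?s)\<^sup>2 = c * c * (cmod (g n))\<^sup>2"
            by (simp add: norm_mult power_mult_distrib power2_eq_square)
          then have "2 * (1 - v) * (cmod ?s)\<^sup>2 = (2 * (1 - v) * c) * (c * (cmod (g n))\<^sup>2)"
            by (simp only: mult_ac)
          then show ?thesis unfolding c by simp
        qed
        moreover have "c * (cmod (g n))\<^sup>2 = (cmod (g n))\<^sup>2 / (2 * (1 - v))" by (simp add: c_def)
        ultimately have "- Re t * (b * of_int n)\<^sup>2 + 2 * Re (?s * g n) - 2 * (1 - v) * (cmod ?s)\<^sup>2 =
            - Re t * (b * of_int n)\<^sup>2 + (cmod (g n))\<^sup>2 / (2 * (1 - v))"
          by linarith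
        then show ?thesis using M[of n ?s] exponent[OF t, of n] by metis
      qed
      have "R_fun t \<ge> 0"
      proof (rule ccontr)
        assume "\<not> R_fun t \<ge> 0"
        then have pos: "0 < - 2 * b\<^sup>2 * R_fun t" using assms by (simp add: mult_neg_pos mult_pos_neg)
        \<comment> \<open>The exponent for the mode \<open>n = k\<close> grows like k^2; bounding k
          by k^2 brings it to the linear form of
          \<open>nonpos_if_exp_multiples_bounded\<close>.\<close>
        have "exp (real k * (- 2 * b\<^sup>2 * R_fun t)) \<le> M" for k
        proof -
          have "real k \<le> (real_of_int (int k))\<^sup>2"
            by (cases k) (simp_all add: power2_eq_square)
          then have "exp (real k * (- 2 * b\<^sup>2 * R_fun t)) \<le> exp ((real_of_int (int k))\<^sup>2 * (- 2 * b\<^sup>2 * R_fun t))"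
            using pos by (simp only: exp_le_cancel_iff mult_right_mono less_imp_le)
          then show ?thesis using bound[of "int k"] by linarith
        qed
        then have "- 2 * b\<^sup>2 * R_fun t \<le> 0" by (rule nonpos_if_exp_multiples_bounded)
        with pos show False by linarith
      qed
      with t show ?thesis by blast
    qed
  qed
qed

end
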